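(* Let $d\ge1$, let $A=(a_1,\dots,a_N)$ be a full-dimensional flat vector arrangement in $V=\mathbb{R}^d$ with $\varphi\in V^*$ satisfying $\varphi(a_i)=1$ for all $i$, and let $H=\varphi^{-1}(1)$. For every circuit-generic $\rho\in\mathbb{R}^N$, $$f_{A,\rho}(t)=d!\int_{C_{\mathrm{generic}}}h(Q_x;t)\,d\mu(x),$$ where the integral is taken coefficientwise in $t$. In particular, $f_{A,\rho}(t)$ is independent of the circuit-generic vector $\rho$, so it equals the common polynomial $f_A(t)$.
   Context: Vector arrangement: a real $d\times N$ matrix $A$ with columns $a_1,\dots,a_N\in V=\mathbb{R}^d$, also viewed as a linear map $A:\mathbb{R}^N\to V$. It is full-dimensional if its columns span $V$, and flat if there is $\varphi\in V^*$ with $\varphi(a_i)=1$ for all $i\in[N]=\{1,\dots,N\}$. Circuits: $S\subset[N]$ is a circuit if $\{a_i:i\in S\}$ (as a labeled family) is linearly dependent while the columns indexed by any proper subset of $S$ are linearly independent. A circuit vector is a nonzero $c\in\ker A$ whose support is a circuit. $\rho\in\mathbb{R}^N$ is circuit-generic if $\langle\rho,c\rangle\ne0$ for every circuit vector $c$. Labeled bases: $B\subset[N]$ is a labeled basis if $|B|=d$ and $\{a_b:b\in B\}$ is a basis of $V$; $A_B:\mathbb{R}^B\to V$ is the corresponding isomorphism; $\Pi_B=\{\sum_{b\in B}\lambda_ba_b:\lambda_b\in[0,1]\}$. For $j\in[N]\setminus B$ the fundamental circuit vector $c^{B,j}\in\ker A$ has $c^{B,j}_j=1$, $c^{B,j}_B=-A_B^{-1}a_j$,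 and all other coordinates $0$. External semi-activity: a circuit vector $c$ is oriented (with respect to a circuit-generic $\rho$) if $\langle\rho,c\rangle>0$. An index $j\in[N]\setminus B$ is externally semi-active for $B$ if the oriented nonzero multiple of $c^{B,j}$ has positive $j$-th coordinate (equivalently $\langle\rho,c^{B,j}\rangle>0$); $\operatorname{ext}_\rho(B)$ is the number of such $j$. Define $f_{A,\rho}(t)=\sum_Bt^{\operatorname{ext}_\rho(B)}\operatorname{Vol}\Pi_B$, sum over all labeled bases $B$, with $\operatorname{Vol}$ Lebesgue measure on $V$. Fibers: $C=\operatorname{conv}\{a_1,\dots,a_N\}\subset H$, $C^\circ$ is its relative interior in $H$, and $$C_{\mathrm{generic}}=C^\circ\setminus\bigcup_{\emptyset\ne S\subset[N],\,|S|<d}\operatorname{conv}\{a_i:i\in S\}.$$ For $x\in C$, the barycentric fiber is $Q_x=\{\lambda\in\mathbb{R}^N_{\ge0}:A\lambda=x\}$; for $x\in C_{\mathrm{generic}}$ it is a simple polytope of dimension $N-d$. $h$-polynomial: for a simple polytope $Q$, $h(Q;t)=\sum_{\emptyset\ne F\le Q}(t-1)^{\dim F}$, sum over all nonempty faces $F$ of $Q$ (including $Q$ itself). Measure: $\mu$ is the Borel measure on $H$ given by $\mu(S)=\operatorname{Vol}(\{sx:x\in S,\ 0\le s\le1\})$ for Borel $S\subset H$. *)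

theory Defs
  imports "HOL-Analysis.Analysis" "HOL-Computational_Algebra.Polynomial"
begin

text \<open>
  A vector arrangement of \<open>N\<close> vectors in \<open>\<real>\<^sup>d\<close> is a matrix \<open>A :: real^'n^'d\<close> with
  \<open>N = CARD('n)\<close> and \<open>d = CARD('d)\<close>; its vectors are the columns \<open>column i A\<close>, its index set
  \<open>[N]\<close> is the type \<open>'n\<close>, and as a linear map it is \<open>(*v) A\<close>.
\<close>

definition full_dimensional :: "real^'n^'d \<Rightarrow> bool" where
  "full_dimensional A \<longleftrightarrow> span (columns A) = UNIV"


text \<open>Independence of a labeled family: repeated columns count as dependent.\<close>

definition indep_family :: "real^'n^'d \<Rightarrow> 'n set \<Rightarrow> bool" where
  "indep_family A S \<longleftrightarrow>
     inj_on (\<lambda>i. column i A) S \<and> independent ((\<lambda>i. column i A) ` S)"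

definition circuit :: "real^'n^'d \<Rightarrow> 'n set \<Rightarrow> bool" where
  "circuit A S \<longleftrightarrow> \<not> indep_family A S \<and> (\<forall>T. T \<subset> S \<longrightarrow> indep_family A T)"

definition circuit_vector :: "real^'n^'d \<Rightarrow> real^'n \<Rightarrow> bool" where
  "circuit_vector A c \<longleftrightarrow> c \<noteq> 0 \<and> A *v c = 0 \<and> circuit A {i. c $ i \<noteq> 0}"

definition circuit_generic :: "real^'n^'d \<Rightarrow> real^'n \<Rightarrow> bool" where
  "circuit_generic A \<rho> \<longleftrightarrow> (\<forall>c. circuit_vector A c \<longrightarrow> \<rho> \<bullet> c \<noteq> 0)"

definition oriented_circuit_vector :: "real^'n^'d \<Rightarrow> real^'n \<Rightarrow> real^'n \<Rightarrow> bool" where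
  "oriented_circuit_vector A \<rho> c \<longleftrightarrow> circuit_vector A c \<and> \<rho> \<bullet> c > 0"


definition labeled_basis :: "real^'n^'d \<Rightarrow> 'n set \<Rightarrow> bool" where
  "labeled_basis A B \<longleftrightarrow>
     card B = CARD('d) \<and>
     independent ((\<lambda>b. column b A) ` B) \<and> span ((\<lambda>b. column b A) ` B) = UNIV"

definition parallelepiped :: "real^'n^'d \<Rightarrow> 'n set \<Rightarrow> (real^'d) set" where
  "parallelepiped A B =
     {(\<Sum>b\<in>B. l b *\<^sub>R column b A) | l. \<forall>b\<in>B. 0 \<le> l b \<and> l b \<le> 1}"

text \<open>
  \<open>\<real>\<^sup>B\<close> is embedded in \<open>\<real>\<^sup>N\<close> as the vectors supported on \<open>B\<close>, so \<open>A\<^sub>B\<close> is the restriction of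
  \<open>(*v) A\<close> to them. For a labeled basis it is bijective and \<open>inv_into\<close> is its genuine inverse.
\<close>

definition basis_inverse :: "real^'n^'d \<Rightarrow> 'n set \<Rightarrow> real^'d \<Rightarrow> real^'n" where
  "basis_inverse A B = inv_into {x. \<forall>i. i \<notin> B \<longrightarrow> x $ i = 0} ((*v) A)"

definition fundamental_circuit_vector :: "real^'n^'d \<Rightarrow> 'n set \<Rightarrow> 'n \<Rightarrow> real^'n" where
  "fundamental_circuit_vector A B j =
     (\<chi> i. if i = j then 1
          else if i \<in> B then - (basis_inverse A B (column j A) $ i)
          else 0)"

text \<open>The oriented nonzero multiple is determined only up to a positive factor.\<close>

definition externally_semi_active :: "real^'n^'d \<Rightarrow> real^'n \<Rightarrow> 'n set \<Rightarrow> 'n \<Rightarrow> bool" where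
  "externally_semi_active A \<rho> B j \<longleftrightarrow>
     j \<notin> B \<and>
     (\<exists>s. s \<noteq> 0 \<and> oriented_circuit_vector A \<rho> (s *\<^sub>R fundamental_circuit_vector A B j) \<and>
          (s *\<^sub>R fundamental_circuit_vector A B j) $ j > 0)"

definition ext_semi :: "real^'n^'d \<Rightarrow> real^'n \<Rightarrow> 'n set \<Rightarrow> nat" where
  "ext_semi A \<rho> B = card {j. externally_semi_active A \<rho> B j}"

definition f_poly :: "real^'n^'d \<Rightarrow> real^'n \<Rightarrow> real poly" where
  "f_poly A \<rho> =
     (\<Sum>B | labeled_basis A B. monom (measure lebesgue (parallelepiped A B)) (ext_semi A \<rho> B))"

text \<open>The common value of \<open>f_poly A \<rho>\<close> over all circuit-generic \<open>\<rho>\<close>.\<close>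

definition common_f_poly :: "real^'n^'d \<Rightarrow> real poly" where
  "common_f_poly A = (THE p. \<forall>\<rho>. circuit_generic A \<rho> \<longrightarrow> f_poly A \<rho> = p)"


text \<open>\<open>H\<close> is the hyperplane containing all columns; the interior of \<open>C\<close> is taken inside \<open>H\<close>.\<close>

definition generic_points :: "real^'n^'d \<Rightarrow> (real^'d) set \<Rightarrow> (real^'d) set" where
  "generic_points A H =
     (top_of_set H interior_of (convex hull (columns A))) -
     \<Union> {convex hull ((\<lambda>i. column i A) ` S) | S. S \<noteq> {} \<and> card S < CARD('d)}"

definition barycentric_fiber :: "real^'n^'d \<Rightarrow> real^'d \<Rightarrow> (real^'n) set" where
  "barycentric_fiber A x = {l. (\<forall>i. 0 \<le> l $ i) \<and> A *v l = x}"

text \<open>The linear polynomial \<open>[:-1, 1:]\<close> is \<open>t - 1\<close>.\<close>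

definition h_poly :: "'a::euclidean_space set \<Rightarrow> real poly" where
  "h_poly Q = (\<Sum>F | F face_of Q \<and> F \<noteq> {}. [:-1, 1:] ^ nat (aff_dim F))"


definition cone_over :: "'a::real_vector set \<Rightarrow> 'a set" where
  "cone_over S = {s *\<^sub>R x | s x. x \<in> S \<and> 0 \<le> s \<and> s \<le> 1}"

definition cone_measure :: "'a::euclidean_space set \<Rightarrow> 'a measure" where
  "cone_measure H =
     measure_of H (sets (restrict_space borel H)) (\<lambda>S. emeasure lebesgue (cone_over S))"

text \<open>
  \<open>measure_of\<close> yields the zero measure unless the given set function is countably additive;
  for the hyperplanes of interest it is, so \<open>cone_measure\<close> has the intended values.
\<close>

lemma sets_cone_measure: "sets (cone_measure H) = sets (restrict_space borel H)"
  unfolding cone_measure_def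
  by (metis sets.sigma_sets_eq sets.space_closed sets_measure_of space_restrict_space
        space_borel Int_UNIV_right)

lemma emeasure_cone_measure:
  fixes \<phi> :: "'a::euclidean_space \<Rightarrow> real"
  assumes lin: "linear \<phi>" and H: "H = \<phi> -` {1}" and S: "S \<in> sets (restrict_space borel H)"
  shows "emeasure (cone_measure H) S = emeasure lebesgue (cone_over S)"
proof -
  define G where "G S = {v. 0 < \<phi> v \<and> \<phi> v \<le> 1 \<and> v /\<^sub>R \<phi> v \<in> S}" for S :: "'a set"
  have cont: "continuous_on UNIV \<phi>"
    using lin by (simp add: linear_continuous_on linear_conv_bounded_linear)
  have [measurable]: "\<phi> \<in> borel_measurable borel"
    using cont by (rule borel_measurable_continuous_onI)
  have "closed H"
    unfolding H using cont by (intro continuous_closed_vimage) (auto simp: continuous_on_eq_continuous_at)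
  then have Hb: "H \<in> sets borel" by simp
  have setsR: "T \<in> sets (restrict_space borel H) \<longleftrightarrow> T \<subseteq> H \<and> T \<in> sets borel" for T
    using Hb by (auto simp: sets_restrict_space_iff)
  have Gb: "G T \<in> sets borel" if [measurable]: "T \<in> sets borel" for T
    unfolding G_def by measurable
  have Geq: "G T = cone_over T - {0}" if "T \<subseteq> H" for T
  proof -
    have *: "\<phi> (s *\<^sub>R x) = s" if "x \<in> T" for s x
      using that \<open>T \<subseteq> H\<close> H lin by (auto simp: linear_scale)
    have "v \<in> cone_over T - {0}" if "v \<in> G T" for v
    proof -
      have "v = \<phi> v *\<^sub>R (v /\<^sub>R \<phi> v)" "v /\<^sub>R \<phi> v \<in> T" "0 < \<phi> v" "\<phi> v \<le> 1"
        using that by (auto simp: G_def)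
      moreover have "v \<noteq> 0" using \<open>0 < \<phi> v\<close> lin linear_0 by force
      ultimately show ?thesis unfolding cone_over_def
        by (smt (verit, ccfv_SIG) Diff_iff mem_Collect_eq singletonD)
    qed
    moreover have "v \<in> G T" if v: "v \<in> cone_over T - {0}" for v
    proof -
      obtain s x where sx: "v = s *\<^sub>R x" "x \<in> T" "0 \<le> s" "s \<le> 1" "v \<noteq> 0"
        using v by (auto simp: cone_over_def)
      then have "s > 0" by (cases "s = 0") auto
      with sx *[of x s] show ?thesis by (auto simp: G_def)
    qed
    ultimately show ?thesis by blast
  qed
  have em: "emeasure lebesgue (cone_over T) = emeasure lebesgue (G T)"
    and Gl: "G T \<in> sets lebesgue" if T: "T \<in> sets (restrict_space borel H)" for T
  proof -
    have T': "T \<subseteq> H" "T \<in> sets borel" using T setsR by auto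
    show 1: "G T \<in> sets lebesgue" using Gb[OF T'(2)] by simp
    have n: "{0} \<in> null_sets (lebesgue :: 'a measure)"
      by (simp add: negligible_iff_null_sets[symmetric])
    have "cone_over T = G T \<or> cone_over T = G T \<union> {0}"
      using Geq[OF T'(1)] by blast
    then show "emeasure lebesgue (cone_over T) = emeasure lebesgue (G T)"
      using emeasure_Un_null_set[OF 1 n] by auto
  qed
  show ?thesis
  proof (rule emeasure_measure_of[OF cone_measure_def])
    show "sets (restrict_space borel H) \<subseteq> Pow H"
      using setsR by auto
    show "positive (sets (cone_measure H)) (\<lambda>S. emeasure lebesgue (cone_over S))"
      by (simp add: positive_def cone_over_def)
    show "S \<in> sets (cone_measure H)" using S by (simp add: sets_cone_measure)
    show "countably_additive (sets (cone_measure H)) (\<lambda>S. emeasure lebesgue (cone_over S))"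
      unfolding sets_cone_measure
    proof (rule countably_additiveI)
      fix F :: "nat \<Rightarrow> 'a set"
      assume F: "range F \<subseteq> sets (restrict_space borel H)" "disjoint_family F"
        "(\<Union>i. F i) \<in> sets (restrict_space borel H)"
      have Fi: "F i \<in> sets (restrict_space borel H)" for i using F(1) by auto
      have "(\<Sum>i. emeasure lebesgue (cone_over (F i))) = (\<Sum>i. emeasure lebesgue (G (F i)))"
        using em[OF Fi] by simp
      also have "\<dots> = emeasure lebesgue (\<Union>i. G (F i))"
      proof (rule suminf_emeasure)
        show "range (\<lambda>i. G (F i)) \<subseteq> sets lebesgue" using Gl[OF Fi] by auto
        show "disjoint_family (\<lambda>i. G (F i))"
          using F(2) unfolding disjoint_family_on_def G_def by blast
      qed
      also have "(\<Union>i. G (F i)) = G (\<Union>i. F i)" by (auto simp: G_def)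
      finally show "(\<Sum>i. emeasure lebesgue (cone_over (F i))) =
          emeasure lebesgue (cone_over (\<Union>i. F i))"
        using em[OF F(3)] by simp
    qed
  qed
qed

end

theory Submission
  imports Defs
begin

text \<open>
  Fix a circuit-generic \<open>\<rho>\<close> and regard it as a linear functional on the fibers. Over a generic
  point \<open>x\<close> the fiber \<open>Q\<^sub>x\<close> is a simple polytope. Its vertices correspond to the labeled bases
  \<open>B\<close> whose simplex \<open>conv {a\<^sub>b : b \<in> B}\<close> contains \<open>x\<close>; the edges leaving such a vertex have the
  directions of the fundamental circuit vectors \<open>c\<^sup>B\<^sup>,\<^sup>j\<close>, and \<open>\<rho>\<close> increases along the edge for
  \<open>j\<close> exactly when \<open>j\<close> is externally semi-active. Each face has a unique vertex at which \<open>\<rho>\<close>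
  is minimal (\<open>exists_minimizing_basis\<close>, \<open>semi_active_basis_minimizes\<close>), and each set of increasing
  edges at a vertex spans a face with that minimal vertex (\<open>basis_extension_is_support\<close>). Grouping
  the faces by their minimal vertices gives
  \<open>h(Q\<^sub>x; t) = \<Sum>\<^sub>B \<Sum>\<^sub>J (t - 1) ^ card J = \<Sum>\<^sub>B t ^ ext(B)\<close>, where \<open>B\<close> runs over the bases with
  \<open>x\<close> in their simplex and \<open>J\<close> over the sets of semi-active indices
  (\<open>h_poly_barycentric_fiber\<close>).

  Integrating over \<open>x\<close>, the basis \<open>B\<close> contributes \<open>t ^ ext(B)\<close> times the measure of the generic
  points of its simplex. The other points of the simplex lie in hulls of fewer than \<open>d\<close> columns,
  whose cones have measure zero, and the cone over the simplex has volume \<open>Vol \<Pi>\<^sub>B / d!\<close>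
  (\<open>measure_parallelepiped\<close>, \<open>cone_measure_basis_hull\<close>). So \<open>d!\<close> times the integral is the sum
  defining \<open>f_poly\<close>. The integrand does not mention \<open>\<rho>\<close>, which gives the independence of
  \<open>\<rho>\<close>.
\<close>

section \<open>Supports, bases and basis coordinates\<close>

definition support_of :: "real^'n \<Rightarrow> 'n set" where
  "support_of l = {i. l $ i \<noteq> 0}"

lemma nth_eq_0_off_support: "support_of l \<subseteq> S \<Longrightarrow> i \<notin> S \<Longrightarrow> l $ i = 0"
  by (auto simp: support_of_def)

lemma support_of_subsetI: "(\<And>i. i \<notin> S \<Longrightarrow> l $ i = 0) \<Longrightarrow> support_of l \<subseteq> S"
  by (auto simp: support_of_def)

lemma support_of_eq_empty [simp]: "support_of l = {} \<longleftrightarrow> l = 0"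
  by (auto simp: support_of_def vec_eq_iff)

lemma support_of_diff: "support_of (l - m) \<subseteq> support_of l \<union> support_of m"
  by (auto simp: support_of_def)

lemma support_of_add: "support_of (l + m) \<subseteq> support_of l \<union> support_of m"
  by (auto simp: support_of_def)

lemma support_of_scaleR: "s \<noteq> 0 \<Longrightarrow> support_of (s *\<^sub>R l) = support_of l"
  by (auto simp: support_of_def)

lemma matrix_vector_mult_eq_sum_columns:
  fixes A :: "real^'n^'d"
  assumes "support_of l \<subseteq> S"
  shows "A *v l = (\<Sum>i\<in>S. l $ i *\<^sub>R column i A)"
  unfolding matrix_mult_sum scalar_mult_eq_scaleR
  using assms by (intro sum.mono_neutral_right) (auto simp: support_of_def)

text \<open>
  Kernel vectors treat both ways of being dependent alike: a repeated column is the kernel vector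
  \<open>axis i 1 - axis j 1\<close>, and a linear relation between distinct columns is one as well.
\<close>

lemma indep_family_iff_kernel:
  fixes A :: "real^'n^'d"
  shows "indep_family A S \<longleftrightarrow> (\<forall>c. A *v c = 0 \<and> support_of c \<subseteq> S \<longrightarrow> c = 0)"
    (is "_ \<longleftrightarrow> ?R")
proof
  let ?a = "\<lambda>i. column i A"
  assume I: "indep_family A S"
  then have inj: "inj_on ?a S" and ind: "independent (?a ` S)"
    by (auto simp: indep_family_def)
  show ?R
  proof (intro allI impI, elim conjE)
    fix c :: "real^'n" assume c: "A *v c = 0" "support_of c \<subseteq> S"
    define u where "u v = c $ inv_into S ?a v" for v
    have u: "u (?a i) = c $ i" if "i \<in> S" for i
      unfolding u_def using inv_into_f_f[OF inj that] by simp
    have "(\<Sum>v\<in>?a ` S. u v *\<^sub>R v) = (\<Sum>i\<in>S. c $ i *\<^sub>R ?a i)"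
      by (subst sum.reindex[OF inj]) (simp add: u)
    also have "\<dots> = 0"
      using c(1) matrix_vector_mult_eq_sum_columns[OF c(2), of A] by simp
    finally have "\<forall>v\<in>?a ` S. u v = 0"
      using ind unfolding independent_explicit by blast
    then show "c = 0"
      using u c(2) by (auto simp: vec_eq_iff support_of_def)
  qed
next
  let ?a = "\<lambda>i. column i A"
  assume R: ?R
  have inj: "inj_on ?a S"
  proof (rule inj_onI, rule ccontr)
    fix i j assume ij: "i \<in> S" "j \<in> S" "?a i = ?a j" "i \<noteq> j"
    let ?c = "axis i 1 - axis j 1 :: real^'n"
    have "A *v ?c = 0"
      using ij by (simp add: matrix_vector_mult_diff_distrib matrix_vector_mult_basis)
    moreover have "support_of ?c \<subseteq> S"
      using ij by (auto simp: support_of_def axis_def split: if_splits)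
    moreover have "?c \<noteq> 0"
      using ij by (auto simp: vec_eq_iff axis_def)
    ultimately show False using R by blast
  qed
  moreover have "independent (?a ` S)"
    unfolding independent_explicit
  proof (intro conjI allI impI ballI)
    fix u v assume u: "(\<Sum>v\<in>?a ` S. u v *\<^sub>R v) = 0" and v: "v \<in> ?a ` S"
    define c where "c = (\<chi> i. if i \<in> S then u (?a i) else 0)"
    have s: "support_of c \<subseteq> S"
      by (auto simp: c_def support_of_def)
    have "A *v c = (\<Sum>i\<in>S. u (?a i) *\<^sub>R ?a i)"
      unfolding matrix_vector_mult_eq_sum_columns[OF s] by (simp add: c_def)
    also have "\<dots> = 0"
      using u by (simp add: sum.reindex[OF inj])
    finally have "c = 0" using R s by blast
    have "u (?a i) = 0" if "i \<in> S" for i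
    proof -
      have "u (?a i) = c $ i" using that by (simp add: c_def)
      then show ?thesis using \<open>c = 0\<close> by simp
    qed
    then show "u v = 0" using v by blast
  qed simp
  ultimately show "indep_family A S" by (simp add: indep_family_def)
qed

lemma labeled_basis_imp_indep_family:
  fixes A :: "real^'n^'d"
  assumes "labeled_basis A B"
  shows "indep_family A B"
proof -
  let ?a = "\<lambda>i. column i A"
  have "card (?a ` B) = CARD('d)"
    using assms dim_eq_card[of "?a ` B" UNIV] by (simp add: labeled_basis_def dim_UNIV)
  then have "inj_on ?a B"
    using assms by (intro eq_card_imp_inj_on) (auto simp: labeled_basis_def)
  then show ?thesis using assms by (simp add: labeled_basis_def indep_family_def)
qed

lemma indep_family_card_le:
  fixes A :: "real^'n^'d"
  assumes "indep_family A S"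
  shows "card S \<le> CARD('d)"
proof -
  have "card ((\<lambda>i. column i A) ` S) = card S"
    using assms by (simp add: indep_family_def card_image)
  then show ?thesis
    using assms independent_bound[of "(\<lambda>i. column i A) ` S"] by (simp add: indep_family_def)
qed

lemma indep_family_imp_labeled_basis:
  fixes A :: "real^'n^'d"
  assumes "indep_family A S" "CARD('d) \<le> card S"
  shows "labeled_basis A S"
proof -
  let ?a = "\<lambda>i. column i A"
  have c: "card (?a ` S) = card S"
    using assms by (simp add: indep_family_def card_image)
  have "UNIV \<subseteq> span (?a ` S)"
    using assms c by (intro card_ge_dim_independent) (auto simp: indep_family_def dim_UNIV)
  then show ?thesis
    using assms indep_family_card_le[OF assms(1)] by (auto simp: labeled_basis_def indep_family_def)
qed

lemma basis_inverse_props: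
  fixes A :: "real^'n^'d"
  assumes B: "labeled_basis A B"
  shows matrix_basis_inverse: "A *v basis_inverse A B y = y"
    and support_basis_inverse: "support_of (basis_inverse A B y) \<subseteq> B"
proof -
  let ?a = "\<lambda>i. column i A" and ?X = "{x::real^'n. \<forall>i. i \<notin> B \<longrightarrow> x $ i = 0}"
  have inj: "inj_on ?a B"
    using labeled_basis_imp_indep_family[OF B] by (simp add: indep_family_def)
  have "y \<in> span (?a ` B)"
    using B by (simp add: labeled_basis_def)
  then obtain u where u: "y = (\<Sum>v\<in>?a ` B. u v *\<^sub>R v)"
    using span_finite[of "?a ` B"] by auto
  define c where "c = (\<chi> i. if i \<in> B then u (?a i) else 0)"
  have s: "support_of c \<subseteq> B"
    by (auto simp: c_def support_of_def)
  have "A *v c = y"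
    unfolding matrix_vector_mult_eq_sum_columns[OF s] u
    by (simp add: c_def sum.reindex[OF inj])
  moreover have "c \<in> ?X" by (simp add: c_def)
  ultimately have y: "y \<in> (*v) A ` ?X" by blast
  show "A *v basis_inverse A B y = y"
    using f_inv_into_f[OF y] by (simp add: basis_inverse_def)
  have "basis_inverse A B y \<in> ?X"
    using inv_into_into[OF y] by (simp add: basis_inverse_def)
  then show "support_of (basis_inverse A B y) \<subseteq> B"
    by (auto simp: support_of_def)
qed

lemma supported_on_basis_eqI:
  fixes A :: "real^'n^'d"
  assumes "labeled_basis A B" "support_of l \<subseteq> B" "support_of m \<subseteq> B" "A *v l = A *v m"
  shows "l = m"
proof -
  have "A *v (l - m) = 0"
    using assms by (simp add: matrix_vector_mult_diff_distrib)
  moreover have "support_of (l - m) \<subseteq> B"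
    using assms support_of_diff by blast
  ultimately have "l - m = 0"
    using labeled_basis_imp_indep_family[OF assms(1)] unfolding indep_family_iff_kernel by blast
  then show ?thesis by simp
qed

lemma basis_inverse_eqI:
  fixes A :: "real^'n^'d"
  assumes "labeled_basis A B" "support_of l \<subseteq> B" "A *v l = y"
  shows "basis_inverse A B y = l"
  by (rule supported_on_basis_eqI[OF assms(1)])
     (use assms matrix_basis_inverse[OF assms(1)] support_basis_inverse[OF assms(1)] in auto)

lemma linear_basis_inverse:
  fixes A :: "real^'n^'d"
  assumes B: "labeled_basis A B"
  shows "linear (basis_inverse A B)"
proof (rule linearI)
  note [simp] = matrix_basis_inverse[OF B]
  note s = support_basis_inverse[OF B]
  show "basis_inverse A B (x + y) = basis_inverse A B x + basis_inverse A B y" for x y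
    using s support_of_add
    by (intro basis_inverse_eqI[OF B]) (blast, simp add: matrix_vector_right_distrib)
  show "basis_inverse A B (r *\<^sub>R x) = r *\<^sub>R basis_inverse A B x" for r x
    using s[of x] 
    by (intro basis_inverse_eqI[OF B])
       (auto simp: support_of_def matrix_vector_mult_scaleR)
qed

section \<open>Fundamental circuits and semi-activity\<close>

lemma fundamental_circuit_vector_eq:
  fixes A :: "real^'n^'d"
  assumes "labeled_basis A B" "j \<notin> B"
  shows "fundamental_circuit_vector A B j = axis j 1 - basis_inverse A B (column j A)"
  using assms nth_eq_0_off_support[OF support_basis_inverse[OF assms(1)]]
  by (auto simp: fundamental_circuit_vector_def vec_eq_iff axis_def)

lemma fundamental_circuit_vector_nth:
  "j \<notin> B \<Longrightarrow> i \<notin> B \<Longrightarrow> fundamental_circuit_vector A B j $ i = (if i = j then 1 else 0)"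
  by (simp add: fundamental_circuit_vector_def)

lemma matrix_fundamental_circuit_vector:
  fixes A :: "real^'n^'d"
  assumes "labeled_basis A B" "j \<notin> B"
  shows "A *v fundamental_circuit_vector A B j = 0"
  using assms
  by (simp add: fundamental_circuit_vector_eq matrix_vector_mult_diff_distrib
      matrix_vector_mult_basis matrix_basis_inverse)

lemma support_fundamental_circuit_vector:
  "support_of (fundamental_circuit_vector A B j) \<subseteq> insert j B"
  by (auto simp: support_of_def fundamental_circuit_vector_def split: if_splits)

text \<open>
  The kernel of \<open>A\<close> on \<open>insert j B\<close> is a line, because subtracting the right multiple of the
  fundamental circuit vector leaves a kernel vector supported on the basis \<open>B\<close>, which is zero.
\<close>

lemma kernel_supported_on_insert_basis:
  fixes A :: "real^'n^'d"
  assumes B: "labeled_basis A B" and j: "j \<notin> B"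
    and v: "A *v v = 0" "support_of v \<subseteq> insert j B"
  shows "v = v $ j *\<^sub>R fundamental_circuit_vector A B j"
proof -
  let ?c = "fundamental_circuit_vector A B j"
  let ?w = "v - v $ j *\<^sub>R ?c"
  have "A *v ?w = A *v 0"
    using v matrix_fundamental_circuit_vector[OF B j]
    by (simp add: matrix_vector_mult_diff_distrib matrix_vector_mult_scaleR)
  moreover have "?w $ i = 0" if "i \<notin> B" for i
    using that j nth_eq_0_off_support[OF v(2)] fundamental_circuit_vector_nth[OF j that, of A]
    by auto
  then have "support_of ?w \<subseteq> B" by (rule support_of_subsetI)
  ultimately have "?w = 0"
    by (intro supported_on_basis_eqI[OF B]) (auto simp: support_of_def)
  then show ?thesis by (rule right_minus_eq[THEN iffD1])
qed

text \<open>
  A proper subset of the support is independent, since a nonzero kernel vector on it would lie on the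
  line spanned by the fundamental circuit vector and so have the full support.
\<close>

lemma circuit_vector_fundamental:
  fixes A :: "real^'n^'d"
  assumes B: "labeled_basis A B" and j: "j \<notin> B"
  shows "circuit_vector A (fundamental_circuit_vector A B j)"
proof -
  let ?c = "fundamental_circuit_vector A B j"
  have cj: "?c $ j = 1" using fundamental_circuit_vector_nth[OF j j, of A] by simp
  then have nz: "?c \<noteq> 0" by auto
  have ker: "A *v ?c = 0" by (rule matrix_fundamental_circuit_vector[OF B j])
  have "circuit A (support_of ?c)"
    unfolding circuit_def
  proof (intro conjI allI impI)
    show "\<not> indep_family A (support_of ?c)"
      using nz ker by (auto simp: indep_family_iff_kernel)
    fix T assume T: "T \<subset> support_of ?c"
    show "indep_family A T"
      unfolding indep_family_iff_kernel
    proof (intro allI impI, elim conjE)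
      fix v :: "real^'n" assume v: "A *v v = 0" "support_of v \<subseteq> T"
      have eq: "v = v $ j *\<^sub>R ?c"
        using v T support_fundamental_circuit_vector[of A B j]
        by (intro kernel_supported_on_insert_basis[OF B j]) auto
      show "v = 0"
      proof (cases "v $ j = 0")
        case True then show ?thesis by (metis eq scaleR_zero_left)
      next
        case False
        then have "support_of v = support_of ?c" by (subst eq) (rule support_of_scaleR)
        then show ?thesis using v T by blast
      qed
    qed
  qed
  then show ?thesis using nz ker by (simp add: circuit_vector_def support_of_def)
qed

lemma circuit_vector_scaleR:
  "s \<noteq> 0 \<Longrightarrow> circuit_vector A c \<Longrightarrow> circuit_vector A (s *\<^sub>R c)"
  by (simp add: circuit_vector_def matrix_vector_mult_scaleR)

text \<open>
  The \<open>j\<close>-th coordinate of the fundamental circuit vector is 1, so the multiples with positive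
  \<open>j\<close>-th coordinate are the positive ones, and these do not change the sign of the pairing with
  \<open>\<rho>\<close>.
\<close>

lemma externally_semi_active_iff:
  fixes A :: "real^'n^'d"
  assumes B: "labeled_basis A B"
  shows "externally_semi_active A \<rho> B j \<longleftrightarrow>
    j \<notin> B \<and> \<rho> \<bullet> fundamental_circuit_vector A B j > 0"
proof (cases "j \<in> B")
  case False
  let ?c = "fundamental_circuit_vector A B j"
  have cj: "?c $ j = 1" using fundamental_circuit_vector_nth[OF False False, of A] by simp
  have cv: "circuit_vector A ?c" by (rule circuit_vector_fundamental[OF B False])
  have "externally_semi_active A \<rho> B j \<longleftrightarrow> (\<exists>s>0. s * (\<rho> \<bullet> ?c) > 0)"
    using False cj circuit_vector_scaleR[OF _ cv]
    by (simp add: externally_semi_active_def oriented_circuit_vector_def)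
       (metis less_numeral_extra(3))
  also have "\<dots> \<longleftrightarrow> \<rho> \<bullet> ?c > 0"
    by (auto simp: zero_less_mult_iff intro: exI[of _ 1])
  finally show ?thesis using False by simp
qed (simp add: externally_semi_active_def)

text \<open>
  A nonzero kernel vector of smallest support inside the given one works: a dependent proper subset
  of its support would carry a nonzero kernel vector of still smaller support.
\<close>

lemma exists_circuit_vector_in_support:
  fixes A :: "real^'n^'d"
  assumes "A *v v = 0" "v \<noteq> 0"
  obtains c where "circuit_vector A c" "support_of c \<subseteq> support_of v"
proof -
  let ?P = "\<lambda>c. A *v c = 0 \<and> c \<noteq> 0 \<and> support_of c \<subseteq> support_of v"
  have "?P v" using assms by simp
  then obtain c where c: "?P c" and min: "\<And>e. ?P e \<Longrightarrow> card (support_of c) \<le> card (support_of e)"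
    using ex_has_least_nat[of ?P v "\<lambda>c. card (support_of c)"] by blast
  have "circuit A (support_of c)"
    unfolding circuit_def
  proof (intro conjI allI impI)
    show "\<not> indep_family A (support_of c)"
      using c by (auto simp: indep_family_iff_kernel)
    fix T assume T: "T \<subset> support_of c"
    show "indep_family A T"
      unfolding indep_family_iff_kernel
    proof (intro allI impI, elim conjE, rule ccontr)
      fix e assume e: "A *v e = 0" "support_of e \<subseteq> T" "e \<noteq> 0"
      then have "card (support_of c) \<le> card (support_of e)"
        using T c by (intro min) auto
      moreover have "card (support_of e) < card (support_of c)"
        using e T by (intro psubset_card_mono) auto
      ultimately show False by simp
    qed
  qed
  then have "circuit_vector A c" using c by (simp add: circuit_vector_def support_of_def)
  then show ?thesis using c that by blast
qed


text \<open>
  The fundamental circuit vectors form a basis of \<open>ker A\<close> dual to the coordinates outside \<open>B\<close>.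
  In the fiber over \<open>x\<close> they are the directions of the edges leaving the vertex given by \<open>B\<close>.
\<close>

lemma kernel_eq_sum_fundamental:
  fixes A :: "real^'n^'d"
  assumes B: "labeled_basis A B" and v: "A *v v = 0"
  shows "v = (\<Sum>j\<in>-B. v $ j *\<^sub>R fundamental_circuit_vector A B j)"
proof -
  let ?c = "fundamental_circuit_vector A B"
  let ?w = "v - (\<Sum>j\<in>-B. v $ j *\<^sub>R ?c j)"
  have "A *v (\<Sum>j\<in>-B. v $ j *\<^sub>R ?c j) = (\<Sum>j\<in>-B. v $ j *\<^sub>R (A *v ?c j))"
    by (simp add: linear_sum[OF matrix_vector_mul_linear] matrix_vector_mult_scaleR)
  also have "\<dots> = 0"
    using matrix_fundamental_circuit_vector[OF B] by (intro sum.neutral) auto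
  finally have "A *v ?w = A *v 0"
    using v by (simp add: matrix_vector_mult_diff_distrib)
  moreover have "?w $ i = 0" if i: "i \<notin> B" for i
  proof -
    have "(\<Sum>j\<in>-B. v $ j *\<^sub>R ?c j) $ i = (\<Sum>j\<in>-B. if j = i then v $ j else 0)"
      unfolding sum_component using i
      by (intro sum.cong) (auto simp: fundamental_circuit_vector_nth)
    then show ?thesis using i by simp
  qed
  then have "support_of ?w \<subseteq> B" by (rule support_of_subsetI)
  ultimately have "?w = 0"
    by (intro supported_on_basis_eqI[OF B]) (auto simp: support_of_def)
  then show ?thesis by (rule right_minus_eq[THEN iffD1])
qed

section \<open>Faces of a barycentric fiber\<close>

lemma mem_barycentric_fiber:
  "l \<in> barycentric_fiber A x \<longleftrightarrow> (\<forall>i. 0 \<le> l $ i) \<and> A *v l = x"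
  by (simp add: barycentric_fiber_def)

definition fiber_face :: "real^'n^'d \<Rightarrow> real^'d \<Rightarrow> 'n set \<Rightarrow> (real^'n) set" where
  "fiber_face A x S = {l \<in> barycentric_fiber A x. support_of l \<subseteq> S}"

text \<open>
  Nondegeneracy in the sense of linear programming: no point of the fiber lies on more than \<open>N - d\<close>
  of the hyperplanes \<open>l\<^sub>i = 0\<close>, so the fiber is simple.
\<close>

definition nondegenerate :: "real^'n^'d \<Rightarrow> real^'d \<Rightarrow> bool" where
  "nondegenerate A x \<longleftrightarrow> (\<forall>l\<in>barycentric_fiber A x. CARD('d) \<le> card (support_of l))"

text \<open>
  The vertices of a nondegenerate fiber are the points \<open>basis_inverse A B x\<close> with \<open>B\<close> in this
  set.
\<close>

definition feasible_bases :: "real^'n^'d \<Rightarrow> real^'d \<Rightarrow> 'n set set" where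
  "feasible_bases A x = {B. labeled_basis A B \<and> basis_inverse A B x \<in> barycentric_fiber A x}"

text \<open>
  Each of the finitely many positive coordinates stays positive along a short initial part of the
  ray. Such moves produce the prolonged segments, the edges and the points of larger support below.
\<close>

lemma fiber_move:
  fixes A :: "real^'n^'d"
  assumes l: "l \<in> barycentric_fiber A x" and v: "A *v v = 0" "\<And>i. l $ i = 0 \<Longrightarrow> 0 \<le> v $ i"
  obtains e where "0 < e" "l + e *\<^sub>R v \<in> barycentric_fiber A x"
    "\<And>i. 0 < l $ i \<Longrightarrow> 0 < (l + e *\<^sub>R v) $ i"
proof -
  have "\<forall>\<^sub>F e in at_right 0. \<forall>i. 0 < l $ i \<longrightarrow> 0 < l $ i + e * v $ i"
  proof (rule eventually_all_finite)
    fix i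
    show "\<forall>\<^sub>F e in at_right 0. 0 < l $ i \<longrightarrow> 0 < l $ i + e * v $ i"
    proof (cases "0 < l $ i")
      case True
      have "((\<lambda>e. l $ i + e * v $ i) \<longlongrightarrow> l $ i + 0 * v $ i) (at_right 0)"
        by (intro tendsto_intros)
      then have "\<forall>\<^sub>F e in at_right 0. 0 < l $ i + e * v $ i"
        by (rule order_tendstoD) (use True in simp)
      then show ?thesis by eventually_elim simp
    qed simp
  qed
  moreover have "\<forall>\<^sub>F e in at_right (0::real). 0 < e"
    by (simp add: eventually_at_filter)
  ultimately have "\<forall>\<^sub>F e in at_right 0. 0 < e \<and> (\<forall>i. 0 < l $ i \<longrightarrow> 0 < l $ i + e * v $ i)"
    by eventually_elim simp
  then obtain e where e: "0 < e" and pos: "\<And>i. 0 < l $ i \<Longrightarrow> 0 < l $ i + e * v $ i"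
    using eventually_happens'[OF trivial_limit_at_right_real] by blast
  have "0 \<le> l $ i + e * v $ i" for i
  proof (cases "l $ i = 0")
    case True then show ?thesis using v(2) e by simp
  next
    case False
    then show ?thesis using pos[of i] l by (simp add: mem_barycentric_fiber less_le)
  qed
  moreover have "A *v (l + e *\<^sub>R v) = x"
    using l v by (simp add: mem_barycentric_fiber matrix_vector_right_distrib matrix_vector_mult_scaleR)
  ultimately have "l + e *\<^sub>R v \<in> barycentric_fiber A x"
    by (simp add: mem_barycentric_fiber)
  with e pos show ?thesis using that by simp
qed

lemma support_convex_combination:
  assumes "\<And>i. 0 \<le> a $ i" "\<And>i. 0 \<le> b $ i" "0 < u" "u < 1"
  shows "support_of ((1 - u) *\<^sub>R a + u *\<^sub>R b) = support_of a \<union> support_of b"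
proof -
  have "(1 - u) * a $ i + u * b $ i = 0 \<longleftrightarrow> a $ i = 0 \<and> b $ i = 0" for i
    using assms by (subst add_nonneg_eq_0_iff) auto
  then show ?thesis by (auto simp: support_of_def)
qed

lemma convex_barycentric_fiber: "convex (barycentric_fiber A x)"
  by (auto simp: convex_def mem_barycentric_fiber matrix_vector_right_distrib
      matrix_vector_mult_scaleR simp flip: scaleR_add_left)

lemma face_of_fiber_face: "fiber_face A x S face_of barycentric_fiber A x"
  unfolding face_of_def
proof (intro conjI ballI impI)
  show "convex (fiber_face A x S)"
  proof (rule convexI)
    fix a b :: "real^'a" and u v :: real
    assume *: "a \<in> fiber_face A x S" "b \<in> fiber_face A x S" "0 \<le> u" "0 \<le> v" "u + v = 1"
    then have "u *\<^sub>R a + v *\<^sub>R b \<in> barycentric_fiber A x"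
      using convex_barycentric_fiber[of A x] by (simp add: convex_def fiber_face_def)
    moreover have "support_of (u *\<^sub>R a + v *\<^sub>R b) \<subseteq> S"
      using * nth_eq_0_off_support[of a S] nth_eq_0_off_support[of b S]
      by (intro support_of_subsetI) (simp add: fiber_face_def)
    ultimately show "u *\<^sub>R a + v *\<^sub>R b \<in> fiber_face A x S"
      by (simp add: fiber_face_def)
  qed
next
  fix a b l
  assume *: "a \<in> barycentric_fiber A x" "b \<in> barycentric_fiber A x" "l \<in> fiber_face A x S"
    "l \<in> open_segment a b"
  then obtain u where u: "0 < u" "u < 1" "l = (1 - u) *\<^sub>R a + u *\<^sub>R b"
    by (auto simp: in_segment)
  have "support_of a \<union> support_of b \<subseteq> S"
    using * support_convex_combination[of a b u] u by (auto simp: mem_barycentric_fiber fiber_face_def)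
  then show "a \<in> fiber_face A x S" "b \<in> fiber_face A x S"
    using * by (auto simp: fiber_face_def)
qed (auto simp: fiber_face_def)

text \<open>
  The support of a point \<open>l\<close> of \<open>F\<close> with as many nonzero coordinates as possible contains the
  support of each point of \<open>F\<close>, since midpoints add up supports. Conversely, if the support of
  \<open>m\<close> lies in that of \<open>l\<close>, the segment from \<open>m\<close> to \<open>l\<close> can be prolonged beyond \<open>l\<close>
  inside the fiber, so the face property puts \<open>m\<close> into \<open>F\<close>.
\<close>

lemma face_of_fiber_imp_fiber_face:
  assumes F: "F face_of barycentric_fiber A x" "F \<noteq> {}"
  obtains l where "l \<in> barycentric_fiber A x" "F = fiber_face A x (support_of l)"
proof -
  let ?Q = "barycentric_fiber A x"
  have FQ: "F \<subseteq> ?Q" using F(1) by (rule face_of_imp_subset)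
  obtain l0 where "l0 \<in> F" using F(2) by blast
  then obtain l where l: "l \<in> F" and max: "\<And>m. m \<in> F \<Longrightarrow> card (support_of m) \<le> card (support_of l)"
    using ex_has_greatest_nat[of "\<lambda>m. m \<in> F" l0 "\<lambda>m. card (support_of m)" "Suc CARD('a)"]
    by (auto simp: card_mono less_Suc_eq_le)
  have "m \<in> fiber_face A x (support_of l)" if m: "m \<in> F" for m
  proof -
    have "(1 - 1/2) *\<^sub>R l + (1/2) *\<^sub>R m \<in> F"
      using l m face_of_imp_convex[OF F(1)] by (intro convexD) auto
    moreover have "support_of ((1 - 1/2) *\<^sub>R l + (1/2) *\<^sub>R m) = support_of l \<union> support_of m"
      using l m FQ by (intro support_convex_combination) (auto simp: mem_barycentric_fiber)
    ultimately have "card (support_of l \<union> support_of m) \<le> card (support_of l)"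
      using max by metis
    then have "support_of l = support_of l \<union> support_of m"
      by (intro card_seteq) auto
    then show ?thesis using m FQ by (auto simp: fiber_face_def)
  qed
  moreover have "m \<in> F" if m: "m \<in> fiber_face A x (support_of l)" for m
  proof (cases "m = l")
    case False
    have lQ: "l \<in> ?Q" and mQ: "m \<in> ?Q" using l FQ m by (auto simp: fiber_face_def)
    have "A *v (l - m) = 0"
      using lQ mQ by (simp add: mem_barycentric_fiber matrix_vector_mult_diff_distrib)
    moreover have "0 \<le> (l - m) $ i" if "l $ i = 0" for i
    proof -
      have "m $ i = 0"
        using that m nth_eq_0_off_support[of m "support_of l" i]
        by (simp add: fiber_face_def support_of_def)
      then show ?thesis using that by simp
    qed
    ultimately obtain e where e: "0 < e" "l + e *\<^sub>R (l - m) \<in> ?Q"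
      using fiber_move[OF lQ] by blast
    let ?z = "l + e *\<^sub>R (l - m)"
    have ne: "?z \<noteq> m"
    proof
      assume "?z = m"
      then have "(1 + e) *\<^sub>R (l - m) = 0" by (simp add: algebra_simps)
      then show False using e False by simp
    qed
    \<comment> \<open>The weight for which \<open>l\<close> is the point of the segment from \<open>?z\<close> to \<open>m\<close>.\<close>
    define w where "w = e / (1 + e)"
    have w: "0 < w" "w < 1" "e - w * (1 + e) = 0" using e(1) by (simp_all add: w_def field_simps)
    have "(1 - w) *\<^sub>R ?z + w *\<^sub>R m = l + (e - w * (1 + e)) *\<^sub>R (l - m)"
      by (simp add: algebra_simps)
    then have "l = (1 - w) *\<^sub>R ?z + w *\<^sub>R m" using w(3) by simp
    then have "l \<in> open_segment ?z m"
      using ne w(1,2) unfolding in_segment by blast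
    then show ?thesis using F(1) l e mQ unfolding face_of_def by blast
  qed (use l in simp)
  ultimately have "F = fiber_face A x (support_of l)" by blast
  then show ?thesis using that l FQ by blast
qed

text \<open>
  The point \<open>l\<close> lies in the relative interior of this face. So the directions of the face span the
  kernel vectors supported on \<open>support_of l\<close>, which have as basis the fundamental circuit vectors
  \<open>c\<^sup>B\<^sup>,\<^sup>j\<close> with \<open>j\<close> in \<open>support_of l - B\<close>.
\<close>

lemma aff_dim_fiber_face:
  fixes A :: "real^'n^'d"
  assumes l: "l \<in> barycentric_fiber A x" and B: "labeled_basis A B" "B \<subseteq> support_of l"
  shows "aff_dim (fiber_face A x (support_of l)) = int (card (support_of l) - CARD('d))"
proof -
  let ?F = "fiber_face A x (support_of l)" and ?c = "fundamental_circuit_vector A B"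
  let ?D = "(\<lambda>m. m - l) ` ?F" and ?J = "support_of l - B"
  have lF: "l \<in> ?F" using l by (simp add: fiber_face_def)
  have inj: "inj_on ?c ?J"
  proof (rule inj_onI)
    fix i j assume ij: "i \<in> ?J" "j \<in> ?J" "?c i = ?c j"
    have "?c i $ i = 1" "?c j $ i = (if i = j then 1 else 0)"
      using ij(1,2) by (simp_all add: fundamental_circuit_vector_nth)
    then show "i = j" using ij(3) by (simp split: if_splits)
  qed
  \<comment> \<open>The \<open>j\<close>-th coordinate of \<open>?c i\<close> is the Kronecker delta for \<open>i, j \<notin> B\<close>.\<close>
  have "independent (?c ` ?J)"
    unfolding independent_explicit
  proof (intro conjI allI impI ballI)
    fix u v assume u: "(\<Sum>v\<in>?c ` ?J. u v *\<^sub>R v) = 0" and v: "v \<in> ?c ` ?J"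
    then obtain j where j: "j \<in> ?J" "v = ?c j" by blast
    have "0 = (\<Sum>i\<in>?J. u (?c i) *\<^sub>R ?c i) $ j"
      using u by (simp add: sum.reindex[OF inj])
    also have "\<dots> = (\<Sum>i\<in>?J. if i = j then u (?c i) else 0)"
      unfolding sum_component using j
      by (intro sum.cong) (auto simp: fundamental_circuit_vector_nth)
    also have "\<dots> = u v" using j by simp
    finally show "u v = 0" by simp
  qed simp
  moreover have "span (?c ` ?J) = span ?D"
    unfolding span_eq
  proof (intro conjI subsetI)
    fix w assume "w \<in> ?c ` ?J"
    then obtain j where j: "j \<in> ?J" "w = ?c j" by blast
    have "0 \<le> ?c j $ i" if "l $ i = 0" for i
    proof -
      have "i \<notin> B" using that B by (auto simp: support_of_def)
      then show ?thesis using j by (simp add: fundamental_circuit_vector_nth)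
    qed
    then obtain e where e: "0 < e" "l + e *\<^sub>R ?c j \<in> barycentric_fiber A x"
      using fiber_move[OF l matrix_fundamental_circuit_vector[OF B(1)]] j by blast
    have "support_of (l + e *\<^sub>R ?c j) \<subseteq> support_of l"
      using support_of_add[of l "e *\<^sub>R ?c j"] support_fundamental_circuit_vector[of A B j] e j B
      by (auto simp: support_of_scaleR)
    then have "l + e *\<^sub>R ?c j \<in> ?F" using e by (simp add: fiber_face_def)
    then have "l + e *\<^sub>R ?c j - l \<in> ?D" by blast
    then have "e *\<^sub>R ?c j \<in> span ?D" by (simp add: span_base)
    then have "(1 / e) *\<^sub>R (e *\<^sub>R ?c j) \<in> span ?D" by (rule span_scale)
    then show "w \<in> span ?D" using e j by simp
  next
    fix w assume "w \<in> ?D"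
    then obtain m where m: "m \<in> ?F" "w = m - l" by blast
    have "A *v w = 0"
      using m l by (simp add: fiber_face_def mem_barycentric_fiber matrix_vector_mult_diff_distrib)
    then have "w = (\<Sum>j\<in>-B. w $ j *\<^sub>R ?c j)" by (rule kernel_eq_sum_fundamental[OF B(1)])
    also have "\<dots> \<in> span (?c ` ?J)"
    proof (rule span_sum)
      fix j assume j: "j \<in> - B"
      show "w $ j *\<^sub>R ?c j \<in> span (?c ` ?J)"
      proof (cases "j \<in> support_of l")
        case True
        then show ?thesis using j by (intro span_scale span_base) auto
      next
        case False
        then have "w $ j = 0"
          using m by (auto simp: fiber_face_def support_of_def)
        then show ?thesis by (simp add: span_zero)
      qed
    qed
    finally show "w \<in> span (?c ` ?J)" .
  qed
  ultimately have "dim ?D = card (?c ` ?J)" by (intro dim_eq_card) auto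
  also have "\<dots> = card ?J" by (rule card_image[OF inj])
  also have "\<dots> = card (support_of l) - CARD('d)"
    using B by (simp add: card_Diff_subset labeled_basis_def)
  finally show ?thesis
    using aff_dim_eq_dim_subtract[of l ?F] lF by (simp add: hull_inc)
qed

section \<open>Minimal vertices and the \<open>h\<close>-polynomial of a fiber\<close>

lemma flat_sum_coordinates:
  fixes A :: "real^'n^'d"
  assumes \<phi>: "linear \<phi>" "\<forall>i. \<phi> (column i A) = (1::real)"
  shows "\<phi> (A *v l) = (\<Sum>i\<in>UNIV. l $ i)"
  by (simp add: matrix_vector_mult_eq_sum_columns[of l UNIV] linear_sum[OF \<phi>(1)]
      linear_scale[OF \<phi>(1)] \<phi>(2))

text \<open>
  Flatness bounds the fiber: the coordinates of its points are nonnegative with sum \<open>\<phi> x\<close>.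
\<close>

lemma compact_fiber_face:
  fixes A :: "real^'n^'d"
  assumes \<phi>: "linear \<phi>" "\<forall>i. \<phi> (column i A) = (1::real)"
  shows "compact (fiber_face A x S)"
proof -
  have "closed {l::real^'n. i \<notin> S \<longrightarrow> l $ i = 0}" for i
    by (cases "i \<in> S") (simp_all add: closed_Collect_eq continuous_intros)
  then have "closed {l::real^'n. (\<forall>i. 0 \<le> l $ i) \<and> A *v l = x \<and> (\<forall>i. i \<notin> S \<longrightarrow> l $ i = 0)}"
    by (intro closed_Collect_conj closed_Collect_all closed_Collect_le closed_Collect_eq
        continuous_intros matrix_vector_mult_linear_continuous_on)
  then have "closed (fiber_face A x S)"
    unfolding fiber_face_def barycentric_fiber_def support_of_def
    by (rule back_subst[of closed]) auto
  moreover have "bounded (fiber_face A x S)"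
  proof (rule bounded_subset[OF bounded_cbox])
    show "fiber_face A x S \<subseteq> cbox 0 (\<chi> i. \<phi> x)"
    proof
      fix l assume "l \<in> fiber_face A x S"
      then have l: "\<And>i. 0 \<le> l $ i" "A *v l = x" 
        by (auto simp: fiber_face_def mem_barycentric_fiber)
      then have "l $ i \<le> \<phi> x" for i
        using flat_sum_coordinates[OF \<phi>, of l] member_le_sum[of i UNIV "\<lambda>i. l $ i"] by simp
      then show "l \<in> cbox 0 (\<chi> i. \<phi> x)" using l by (simp add: mem_box_cart)
    qed
  qed
  ultimately show ?thesis by (simp add: compact_eq_bounded_closed)
qed

text \<open>
  The basis is the support of a minimizer \<open>m\<close> of \<open>\<rho>\<close> on the face. If that support were
  dependent, it would contain a circuit, and moving \<open>m\<close> along the circuit vector or its negative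
  would decrease \<open>\<rho>\<close>, because genericity excludes a vanishing pairing. The edges of the face
  leaving \<open>m\<close> increase \<open>\<rho>\<close>, again strictly by genericity, which is semi-activity.
\<close>

lemma exists_minimizing_basis:
  fixes A :: "real^'n^'d"
  assumes \<phi>: "linear \<phi>" "\<forall>i. \<phi> (column i A) = (1::real)"
    and gen: "circuit_generic A \<rho>" and nd: "nondegenerate A x" and l: "l \<in> barycentric_fiber A x"
  obtains B where "B \<in> feasible_bases A x" "B \<subseteq> support_of l"
    "support_of l - B \<subseteq> {j. externally_semi_active A \<rho> B j}"
proof -
  let ?F = "fiber_face A x (support_of l)"
  have "l \<in> ?F" using l by (simp add: fiber_face_def)
  then obtain m where m: "m \<in> ?F" and min: "\<And>y. y \<in> ?F \<Longrightarrow> \<rho> \<bullet> m \<le> \<rho> \<bullet> y"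
    using continuous_attains_inf[OF compact_fiber_face[OF \<phi>, of x "support_of l"], of "\<lambda>y. \<rho> \<bullet> y"]
    by (fastforce intro: continuous_intros)
  have mQ: "m \<in> barycentric_fiber A x" and ms: "support_of m \<subseteq> support_of l"
    using m by (auto simp: fiber_face_def)
  \<comment> \<open>No admissible direction inside the face can decrease \<open>\<rho>\<close> at its minimizer.\<close>
  have improve: "0 \<le> \<rho> \<bullet> v"
    if v: "A *v v = 0" "support_of v \<subseteq> support_of l" "\<And>i. m $ i = 0 \<Longrightarrow> 0 \<le> v $ i" for v
  proof -
    obtain e where e: "0 < e" "m + e *\<^sub>R v \<in> barycentric_fiber A x"
      using fiber_move[OF mQ v(1,3)] by blast
    have "support_of (m + e *\<^sub>R v) \<subseteq> support_of l"
      using support_of_add[of m "e *\<^sub>R v"] ms v(2) e by (auto simp: support_of_scaleR)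
    then have "\<rho> \<bullet> m \<le> \<rho> \<bullet> (m + e *\<^sub>R v)"
      using e by (intro min) (simp add: fiber_face_def)
    then have "0 \<le> e * (\<rho> \<bullet> v)" by (simp add: inner_add_right)
    then show ?thesis using e(1) by (simp add: zero_le_mult_iff)
  qed
  have "indep_family A (support_of m)"
    unfolding indep_family_iff_kernel
  proof (intro allI impI, elim conjE, rule ccontr)
    fix v :: "real^'n" assume v: "A *v v = 0" "support_of v \<subseteq> support_of m" "v \<noteq> 0"
    obtain c where c: "circuit_vector A c" "support_of c \<subseteq> support_of v"
      using exists_circuit_vector_in_support[OF v(1,3)] .
    have Ac: "A *v c = 0" and cs: "support_of c \<subseteq> support_of m"
      using c v by (auto simp: circuit_vector_def)
    have c0: "c $ i = 0" if "m $ i = 0" for i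
      using cs that by (auto simp: support_of_def)
    have "0 \<le> \<rho> \<bullet> c"
      using Ac cs ms c0 by (intro improve) auto
    moreover have "0 \<le> \<rho> \<bullet> (- 1 *\<^sub>R c)"
    proof (rule improve)
      show "A *v (- 1 *\<^sub>R c) = 0" using Ac by (simp only: matrix_vector_mult_scaleR scaleR_zero_right)
      show "support_of (- 1 *\<^sub>R c) \<subseteq> support_of l" using cs ms by (subst support_of_scaleR) auto
    qed (simp add: c0)
    ultimately have "\<rho> \<bullet> c = 0" by simp
    then show False using gen c by (auto simp: circuit_generic_def)
  qed
  moreover have "CARD('d) \<le> card (support_of m)"
    using nd mQ by (simp add: nondegenerate_def)
  ultimately have B: "labeled_basis A (support_of m)" by (rule indep_family_imp_labeled_basis)
  have "basis_inverse A (support_of m) x = m"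
    using mQ by (intro basis_inverse_eqI[OF B]) (auto simp: mem_barycentric_fiber)
  then have "support_of m \<in> feasible_bases A x"
    using B mQ by (simp add: feasible_bases_def)
  moreover have "externally_semi_active A \<rho> (support_of m) j" if j: "j \<in> support_of l - support_of m" for j
  proof -
    let ?c = "fundamental_circuit_vector A (support_of m) j"
    have jm: "j \<notin> support_of m" using j by simp
    have "0 \<le> \<rho> \<bullet> ?c"
    proof (rule improve)
      show "A *v ?c = 0" by (rule matrix_fundamental_circuit_vector[OF B jm])
      show "support_of ?c \<subseteq> support_of l"
        using support_fundamental_circuit_vector[of A "support_of m" j] j ms by auto
      show "0 \<le> ?c $ i" if "m $ i = 0" for i
      proof -
        have "i \<notin> support_of m" using that by (simp add: support_of_def)
        then show ?thesis using fundamental_circuit_vector_nth[OF jm, of i A] by simp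
      qed
    qed
    moreover have "\<rho> \<bullet> ?c \<noteq> 0"
      using gen circuit_vector_fundamental[OF B jm] by (simp add: circuit_generic_def)
    ultimately show ?thesis by (simp add: externally_semi_active_iff[OF B] jm)
  qed
  ultimately show ?thesis using that ms by blast
qed

text \<open>
  Conversely, a vertex all of whose edges in a face are semi-active is the only minimizer of \<open>\<rho>\<close>
  on it: the difference of another point of the face is a nonnegative combination of the directions
  of these edges.
\<close>

lemma semi_active_basis_minimizes:
  fixes A :: "real^'n^'d"
  assumes B: "B \<in> feasible_bases A x"
    and m: "m \<in> barycentric_fiber A x" "support_of m - B \<subseteq> {j. externally_semi_active A \<rho> B j}"
  shows "\<rho> \<bullet> basis_inverse A B x \<le> \<rho> \<bullet> m"
    and "\<rho> \<bullet> m = \<rho> \<bullet> basis_inverse A B x \<Longrightarrow> m = basis_inverse A B x"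
proof -
  let ?b = "basis_inverse A B x" and ?c = "fundamental_circuit_vector A B"
  have lB: "labeled_basis A B" and bQ: "?b \<in> barycentric_fiber A x"
    using B by (auto simp: feasible_bases_def)
  have b0: "?b $ j = 0" if "j \<notin> B" for j
    using nth_eq_0_off_support[OF support_basis_inverse[OF lB] that] .
  have "A *v (m - ?b) = 0"
    using m bQ by (simp add: mem_barycentric_fiber matrix_vector_mult_diff_distrib)
  then have "m - ?b = (\<Sum>j\<in>-B. (m - ?b) $ j *\<^sub>R ?c j)"
    by (rule kernel_eq_sum_fundamental[OF lB])
  also have "\<dots> = (\<Sum>j\<in>-B. m $ j *\<^sub>R ?c j)"
    by (intro sum.cong) (auto simp: b0)
  finally have d: "m - ?b = (\<Sum>j\<in>-B. m $ j *\<^sub>R ?c j)" .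
  have "\<rho> \<bullet> m - \<rho> \<bullet> ?b = \<rho> \<bullet> (m - ?b)" by (simp add: inner_diff_right)
  also have "\<dots> = (\<Sum>j\<in>-B. m $ j * (\<rho> \<bullet> ?c j))"
    unfolding d by (simp add: inner_sum_right)
  finally have \<rho>: "\<rho> \<bullet> m - \<rho> \<bullet> ?b = (\<Sum>j\<in>-B. m $ j * (\<rho> \<bullet> ?c j))" .
  have pos: "0 < \<rho> \<bullet> ?c j" if "j \<notin> B" "m $ j \<noteq> 0" for j
    using m that by (auto simp: externally_semi_active_iff[OF lB] support_of_def)
  have nn: "0 \<le> m $ j * (\<rho> \<bullet> ?c j)" if "j \<in> -B" for j
    using pos[of j] that m(1) by (cases "m $ j = 0") (auto simp: mem_barycentric_fiber)
  show "\<rho> \<bullet> ?b \<le> \<rho> \<bullet> m"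
    using \<rho> sum_nonneg[of "-B" "\<lambda>j. m $ j * (\<rho> \<bullet> ?c j)"] nn by simp
  assume "\<rho> \<bullet> m = \<rho> \<bullet> ?b"
  then have "\<forall>j\<in>-B. m $ j * (\<rho> \<bullet> ?c j) = 0"
    using \<rho> nn sum_nonneg_eq_0_iff[of "-B" "\<lambda>j. m $ j * (\<rho> \<bullet> ?c j)"] by simp
  then have "m $ j = 0" if "j \<in> -B" for j
    using that pos[of j] by fastforce
  then have "m - ?b = 0" unfolding d by (intro sum.neutral) simp
  then show "m = ?b" by simp
qed

lemma support_feasible_basis:
  fixes A :: "real^'n^'d"
  assumes "nondegenerate A x" "B \<in> feasible_bases A x"
  shows "support_of (basis_inverse A B x) = B"
  using assms support_basis_inverse[of A B x]
  by (intro card_seteq) (auto simp: feasible_bases_def nondegenerate_def labeled_basis_def)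

text \<open>
  Edges at a vertex of a simple polytope span a face independently: moving along the sum of the
  directions in \<open>J\<close> switches on exactly the coordinates in \<open>J\<close>.
\<close>

lemma basis_extension_is_support:
  fixes A :: "real^'n^'d"
  assumes nd: "nondegenerate A x" and B: "B \<in> feasible_bases A x" and J: "J \<inter> B = {}"
  shows "B \<union> J \<in> support_of ` barycentric_fiber A x"
proof -
  let ?b = "basis_inverse A B x" and ?c = "fundamental_circuit_vector A B"
  let ?v = "\<Sum>j\<in>J. ?c j"
  have lB: "labeled_basis A B" and bQ: "?b \<in> barycentric_fiber A x"
    using B by (auto simp: feasible_bases_def)
  have sb: "support_of ?b = B" by (rule support_feasible_basis[OF nd B])
  have v: "?v $ i = (if i \<in> J then 1 else 0)" if "i \<notin> B" for i
  proof -
    have "?v $ i = (\<Sum>j\<in>J. if j = i then 1 else 0)"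
      unfolding sum_component
    proof (intro sum.cong refl)
      fix j assume "j \<in> J"
      then have "j \<notin> B" using J by blast
      then show "?c j $ i = (if j = i then 1 else 0)"
        using that by (auto simp: fundamental_circuit_vector_nth)
    qed
    then show ?thesis by simp
  qed
  have "A *v ?v = (\<Sum>j\<in>J. A *v ?c j)"
    by (simp add: linear_sum[OF matrix_vector_mul_linear])
  also have "\<dots> = 0"
    using matrix_fundamental_circuit_vector[OF lB] J by (intro sum.neutral) auto
  finally have "A *v ?v = 0" .
  moreover have "0 \<le> ?v $ i" if "?b $ i = 0" for i
  proof -
    have "i \<notin> B" using that sb by (auto simp: support_of_def)
    then show ?thesis using v by simp
  qed
  ultimately obtain e where e: "0 < e" "?b + e *\<^sub>R ?v \<in> barycentric_fiber A x"
    and pos: "\<And>i. 0 < ?b $ i \<Longrightarrow> 0 < (?b + e *\<^sub>R ?v) $ i"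
    using fiber_move[OF bQ] by blast
  have "i \<in> support_of (?b + e *\<^sub>R ?v) \<longleftrightarrow> i \<in> B \<union> J" for i
  proof (cases "i \<in> B")
    case True
    then have "0 < ?b $ i"
      using sb bQ by (auto simp: support_of_def mem_barycentric_fiber less_le)
    then show ?thesis using True pos[of i] by (simp add: support_of_def)
  next
    case False
    then have "?b $ i = 0" using sb by (auto simp: support_of_def)
    then show ?thesis using False v[OF False] e(1) by (simp add: support_of_def)
  qed
  then show ?thesis using e(2) by blast
qed

text \<open>
  Every nonempty face is determined by the largest support \<open>S\<close> of its points, and its unique
  \<open>\<rho>\<close>-minimal vertex \<open>B\<close> splits \<open>S\<close> into \<open>B\<close> and a set of semi-active indices, which can
  be any such set and whose size is the dimension of the face. Summing \<open>(t - 1) ^ card J\<close> over all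
  subsets \<open>J\<close> of a set of size \<open>e\<close> gives \<open>t ^ e\<close>.
\<close>

theorem h_poly_barycentric_fiber:
  fixes A :: "real^'n^'d"
  assumes \<phi>: "linear \<phi>" "\<forall>i. \<phi> (column i A) = (1::real)"
    and gen: "circuit_generic A \<rho>" and nd: "nondegenerate A x"
  shows "h_poly (barycentric_fiber A x) =
    (\<Sum>B\<in>feasible_bases A x. monom 1 (ext_semi A \<rho> B))"
proof -
  let ?Q = "barycentric_fiber A x" and ?p = "[:-1, 1:] :: real poly"
  let ?E = "\<lambda>B. {j. externally_semi_active A \<rho> B j}"
  let ?P = "SIGMA B:feasible_bases A x. Pow (?E B)"
  have EB: "?E B \<inter> B = {}" for B by (auto simp: externally_semi_active_def)
  have faces: "bij_betw (fiber_face A x) (support_of ` ?Q) {F. F face_of ?Q \<and> F \<noteq> {}}"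
    unfolding bij_betw_def
  proof (intro conjI inj_onI)
    fix S T assume ST: "S \<in> support_of ` ?Q" "T \<in> support_of ` ?Q" "fiber_face A x S = fiber_face A x T"
    then obtain l m where lm: "l \<in> ?Q" "S = support_of l" "m \<in> ?Q" "T = support_of m" by blast
    have "l \<in> fiber_face A x T" "m \<in> fiber_face A x S"
      using ST(3) lm by (auto simp: fiber_face_def)
    then show "S = T" using lm by (auto simp: fiber_face_def)
  next
    have "fiber_face A x S \<noteq> {}" if "S \<in> support_of ` ?Q" for S
      using that by (auto simp: fiber_face_def)
    moreover have "F \<in> fiber_face A x ` support_of ` ?Q" if F: "F face_of ?Q" "F \<noteq> {}" for F
    proof -
      obtain l where "l \<in> ?Q" "F = fiber_face A x (support_of l)"
        using face_of_fiber_imp_fiber_face[OF F] .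
      then show ?thesis by blast
    qed
    moreover have "fiber_face A x S face_of ?Q" for S
      by (rule face_of_fiber_face)
    ultimately show "fiber_face A x ` support_of ` ?Q = {F. F face_of ?Q \<and> F \<noteq> {}}"
      by (intro equalityI subsetI) auto
  qed
  have dims: "nat (aff_dim (fiber_face A x S)) = card S - CARD('d)" if S: "S \<in> support_of ` ?Q" for S
  proof -
    obtain l where l: "l \<in> ?Q" "S = support_of l" using S by blast
    \<comment> \<open>The dimension formula applies because every support contains a basis.\<close>
    obtain B where "B \<in> feasible_bases A x" "B \<subseteq> support_of l" "support_of l - B \<subseteq> ?E B"
      using exists_minimizing_basis[OF \<phi> gen nd l(1)] .
    then show ?thesis using aff_dim_fiber_face[OF l(1), of B] l(2) by (simp add: feasible_bases_def)
  qed
  have supports: "bij_betw (\<lambda>(B, J). B \<union> J) ?P (support_of ` ?Q)"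
    unfolding bij_betw_def
  proof (intro conjI inj_onI)
    fix p q assume "p \<in> ?P" "q \<in> ?P" "(\<lambda>(B, J). B \<union> J) p = (\<lambda>(B, J). B \<union> J) q"
    then obtain B J C K where p: "p = (B, J)" "B \<in> feasible_bases A x" "J \<subseteq> ?E B"
      and q: "q = (C, K)" "C \<in> feasible_bases A x" "K \<subseteq> ?E C" and eq: "B \<union> J = C \<union> K"
      by auto
    let ?b = "basis_inverse A B x" and ?c = "basis_inverse A C x"
    have bQ: "?b \<in> ?Q" and cQ: "?c \<in> ?Q" using p q by (auto simp: feasible_bases_def)
    have sb: "support_of ?b = B" and sc: "support_of ?c = C"
      using support_feasible_basis[OF nd] p q by auto
    have cB: "support_of ?c - B \<subseteq> ?E B" and bC: "support_of ?b - C \<subseteq> ?E C"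
      using sb sc p q eq by auto
    have "\<rho> \<bullet> ?c = \<rho> \<bullet> ?b"
      using semi_active_basis_minimizes(1)[OF p(2) cQ cB]
        semi_active_basis_minimizes(1)[OF q(2) bQ bC] by simp
    then have "?c = ?b" by (rule semi_active_basis_minimizes(2)[OF p(2) cQ cB])
    then have "B = C" using sb sc by simp
    moreover have "J = K" using \<open>B = C\<close> eq EB[of B] EB[of C] p q by blast
    ultimately show "p = q" using p q by simp
  next
    have "B \<union> J \<in> support_of ` ?Q" if "B \<in> feasible_bases A x" "J \<subseteq> ?E B" for B J
      using that basis_extension_is_support[OF nd, of B J] EB[of B] by blast
    moreover have "S \<in> (\<lambda>(B, J). B \<union> J) ` ?P" if S: "S \<in> support_of ` ?Q" for S
    proof -
      obtain l where l: "l \<in> ?Q" "S = support_of l" using S by blast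
      obtain B where B: "B \<in> feasible_bases A x" "B \<subseteq> S" "S - B \<subseteq> ?E B"
        using exists_minimizing_basis[OF \<phi> gen nd l(1)] l(2) by blast
      then have "(B, S - B) \<in> ?P" "S = (\<lambda>(B, J). B \<union> J) (B, S - B)" by auto
      then show ?thesis by blast
    qed
    ultimately show "(\<lambda>(B, J). B \<union> J) ` ?P = support_of ` ?Q" by fastforce
  qed
  have "h_poly ?Q = (\<Sum>S\<in>support_of ` ?Q. ?p ^ nat (aff_dim (fiber_face A x S)))"
    unfolding h_poly_def by (rule sum.reindex_bij_betw[OF faces, symmetric])
  also have "\<dots> = (\<Sum>S\<in>support_of ` ?Q. ?p ^ (card S - CARD('d)))"
    by (intro sum.cong) (simp_all add: dims)
  also have "\<dots> = (\<Sum>(B, J)\<in>?P. ?p ^ (card (B \<union> J) - CARD('d)))"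
    by (subst sum.reindex_bij_betw[OF supports, symmetric]) (simp add: case_prod_unfold)
  also have "\<dots> = (\<Sum>(B, J)\<in>?P. ?p ^ card J)"
  proof -
    have "?p ^ (card (B \<union> J) - CARD('d)) = ?p ^ card J"
      if BJ: "B \<in> feasible_bases A x" "J \<subseteq> ?E B" for B J
    proof -
      have "card (B \<union> J) = card B + card J"
        using EB[of B] BJ(2) by (intro card_Un_disjoint) auto
      then show ?thesis
        using BJ(1) by (simp add: feasible_bases_def labeled_basis_def)
    qed
    then show ?thesis by (intro sum.cong) auto
  qed
  also have "\<dots> = (\<Sum>B\<in>feasible_bases A x. \<Sum>J\<in>Pow (?E B). ?p ^ card J)"
    by (subst sum.Sigma) auto
  also have "\<dots> = (\<Sum>B\<in>feasible_bases A x. monom 1 (ext_semi A \<rho> B))"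
  proof (intro sum.cong refl)
    fix B
    have "(\<Sum>J\<in>Pow (?E B). ?p ^ card J) = (\<Prod>j\<in>?E B. ?p + 1)"
      by (subst prod_add) auto
    also have "?p + 1 = monom 1 1" by (simp add: one_pCons monom_Suc)
    finally show "(\<Sum>J\<in>Pow (?E B). ?p ^ card J) = monom 1 (ext_semi A \<rho> B)"
      by (simp add: ext_semi_def monom_power)
  qed
  finally show ?thesis .
qed

section \<open>Linear images and Lebesgue measure\<close>

text \<open>
  The determinant formula for the measure of a linear image requires a well-ordered index type. Every
  finite type is in bijection with an initial segment of the natural numbers, which is one, and a
  change of the index type preserves Lebesgue measure.
\<close>

typedef ('a::finite) ordered_index = "{..<CARD('a)}"
  by (rule exI[of _ 0]) simp

lemma bij_betw_Rep_ordered_index: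
  "bij_betw (Rep_ordered_index :: 'a::finite ordered_index \<Rightarrow> nat) UNIV {..<CARD('a)}"
  using type_definition.Rep_range[OF type_definition_ordered_index]
  by (auto simp: bij_betw_def inj_def Rep_ordered_index_inject)

instantiation ordered_index :: (finite) wellorder
begin

definition less_eq_ordered_index :: "'a ordered_index \<Rightarrow> 'a ordered_index \<Rightarrow> bool" where
  "i \<le> j \<longleftrightarrow> Rep_ordered_index i \<le> Rep_ordered_index j"

definition less_ordered_index :: "'a ordered_index \<Rightarrow> 'a ordered_index \<Rightarrow> bool" where
  "i < j \<longleftrightarrow> Rep_ordered_index i < Rep_ordered_index j"

instance
proof
  fix P :: "'a ordered_index \<Rightarrow> bool" and i
  assume step: "\<And>i. (\<And>j. j < i \<Longrightarrow> P j) \<Longrightarrow> P i"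
  show "P i"
  proof (induction i rule: measure_induct_rule[of Rep_ordered_index])
    case (less i)
    show "P i" by (rule step, rule less) (simp add: less_ordered_index_def)
  qed
qed (auto simp: less_eq_ordered_index_def less_ordered_index_def Rep_ordered_index_inject)

end

instance ordered_index :: (finite) finite
  by standard (simp add: bij_betw_finite[OF bij_betw_Rep_ordered_index])

lemma exists_bij_ordered_index: "\<exists>\<pi> :: 'a::finite ordered_index \<Rightarrow> 'a. bij \<pi>"
  by (rule finite_same_card_bij)
     (simp_all add: bij_betw_same_card[OF bij_betw_Rep_ordered_index])

lemma prod_Basis_vec: "(\<Prod>b\<in>(Basis :: (real^'n) set). f b) = (\<Prod>i\<in>UNIV. f (axis i 1))"
proof -
  have basis: "(Basis :: (real^'n) set) = range (\<lambda>i. axis i 1)"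
    by (auto simp: Basis_vec_def)
  have inj: "inj (\<lambda>i. axis i 1 :: real^'n)"
    by (auto simp: inj_def axis_eq_axis)
  show ?thesis
    unfolding basis by (subst prod.reindex[OF inj]) simp
qed

lemma lborel_eq_distr_reindex:
  fixes \<pi> :: "'e::finite \<Rightarrow> 'd::finite"
  assumes \<pi>: "bij \<pi>"
  shows "(lborel :: (real^'d) measure) = distr lborel borel (\<lambda>y::real^'e. \<chi> i. y $ inv \<pi> i)"
    (is "_ = distr lborel borel ?h")
proof (rule lborel_eqI)
  have [measurable]: "?h \<in> borel \<rightarrow>\<^sub>M borel"
    by (intro borel_measurable_continuous_onI continuous_intros continuous_on_component)
  have inv: "inv \<pi> (\<pi> j) = j" "\<pi> (inv \<pi> i) = i" for i j
    using \<pi> by (simp_all add: bij_is_inj bij_is_surj surj_f_inv_f)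
  fix l u :: "real^'d" assume lu: "\<And>b. b \<in> Basis \<Longrightarrow> l \<bullet> b \<le> u \<bullet> b"
  let ?l = "\<chi> j. l $ \<pi> j" and ?u = "\<chi> j. u $ \<pi> j"
  have "y \<in> ?h -` box l u \<longleftrightarrow> y \<in> box ?l ?u" for y
    unfolding vimage_eq mem_box_cart vec_lambda_beta by (metis inv)
  then have "?h -` box l u = box ?l ?u" by blast
  moreover have le: "l $ i \<le> u $ i" for i
    using lu[of "axis i 1"] by (simp add: inner_axis)
  then have "?l \<bullet> b \<le> ?u \<bullet> b" if "b \<in> Basis" for b
    using that by (auto simp: Basis_vec_def inner_axis)
  ultimately have "emeasure (distr lborel borel ?h) (box l u) = (\<Prod>b\<in>Basis. (?u - ?l) \<bullet> b)"
    by (simp add: emeasure_distr emeasure_lborel_box)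
  also have "(\<Prod>b\<in>Basis. (?u - ?l) \<bullet> b) = (\<Prod>j\<in>UNIV. u $ \<pi> j - l $ \<pi> j)"
    by (simp add: prod_Basis_vec inner_axis)
  also have "\<dots> = (\<Prod>i\<in>UNIV. u $ i - l $ i)"
    by (rule prod.reindex_bij_betw[OF \<pi>, of "\<lambda>i. u $ i - l $ i"])
  also have "\<dots> = (\<Prod>b\<in>Basis. (u - l) \<bullet> b)"
    by (simp add: prod_Basis_vec inner_axis)
  finally show "emeasure (distr lborel borel ?h) (box l u) = (\<Prod>b\<in>Basis. (u - l) \<bullet> b)" .
qed simp

text \<open>
  Conjugating \<open>f\<close> by a change of the index type gives a linear map on a space with well-ordered
  indices, and the factor is the absolute value of its determinant.
\<close>

lemma linear_image_scales_measure:
  fixes f :: "real^'d \<Rightarrow> real^'d"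
  assumes f: "linear f"
  shows "\<exists>c. \<forall>S. compact S \<longrightarrow> measure lebesgue (f ` S) = c * measure lebesgue S"
proof -
  obtain \<pi> :: "'d ordered_index \<Rightarrow> 'd" where \<pi>: "bij \<pi>"
    using exists_bij_ordered_index by blast
  define h where "h = (\<lambda>y::real^'d ordered_index. \<chi> i. y $ inv \<pi> i)"
  define k where "k = (\<lambda>x::real^'d. \<chi> j. x $ \<pi> j)"
  have kh: "k (h y) = y" "h (k x) = x" for x y
    using \<pi> by (simp_all add: h_def k_def vec_eq_iff bij_is_inj bij_is_surj surj_f_inv_f)
  have lin: "linear h" "linear k"
    by (auto intro!: linearI simp: h_def k_def vec_eq_iff)
  have cont: "continuous_on S h" "continuous_on T k" for S T
    using lin by (simp_all add: linear_continuous_on linear_conv_bounded_linear)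
  have hm: "h \<in> borel \<rightarrow>\<^sub>M borel"
    using cont(1) by (rule borel_measurable_continuous_onI)
  have h: "measure lebesgue (h ` T) = measure lebesgue T" if T: "compact T" for T
  proof -
    have "compact (h ` T)" using T cont by (intro compact_continuous_image)
    then have hT: "h ` T \<in> sets borel" by (simp add: compact_imp_closed)
    have "measure lebesgue (h ` T) = measure (distr lborel borel h) (h ` T)"
      using hT lborel_eq_distr_reindex[OF \<pi>, folded h_def] by (simp add: measure_completion)
    also have "\<dots> = measure lborel (h -` h ` T)"
      using hT hm by (subst measure_distr) auto
    also have "h -` h ` T = T"
      using kh by (metis injI inj_vimage_image_eq)
    finally show ?thesis
      using T by (simp add: measure_completion compact_imp_closed)
  qed
  let ?g = "k \<circ> f \<circ> h"
  have g: "linear ?g" using lin f by (intro linear_compose)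
  have "measure lebesgue (f ` S) = \<bar>det (matrix ?g)\<bar> * measure lebesgue S" if S: "compact S" for S
  proof -
    have kS: "compact (k ` S)" using S cont by (intro compact_continuous_image)
    have gS: "compact (?g ` k ` S)"
      using kS linear_continuous_on[of ?g "k ` S"] g
      by (intro compact_continuous_image[of "k ` S" ?g]) (simp_all add: linear_conv_bounded_linear)
    have "f ` S = h ` ?g ` k ` S" by (simp add: image_image kh)
    then have "measure lebesgue (f ` S) = measure lebesgue (?g ` k ` S)"
      using h[OF gS] by simp
    also have "\<dots> = \<bar>det (matrix ?g)\<bar> * measure lebesgue (k ` S)"
      by (rule measure_linear_image[OF g lmeasurable_compact[OF kS]])
    also have "measure lebesgue (k ` S) = measure lebesgue S"
      using h[OF kS] by (simp add: image_image kh)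
    finally show ?thesis .
  qed
  then show ?thesis by blast
qed

section \<open>Cones over simplices\<close>

lemma cone_over_convex_hull:
  assumes "X \<noteq> {}"
  shows "cone_over (convex hull X) = convex hull (insert 0 X)"
proof -
  have "(\<exists>u\<ge>0. \<exists>v\<ge>0. \<exists>b. u + v = 1 \<and> b \<in> convex hull X \<and> y = u *\<^sub>R 0 + v *\<^sub>R b) \<longleftrightarrow>
      (\<exists>s b. y = s *\<^sub>R b \<and> b \<in> convex hull X \<and> 0 \<le> s \<and> s \<le> 1)" (is "?L \<longleftrightarrow> ?R") for y
  proof
    assume ?R
    then obtain s b where "y = s *\<^sub>R b" "b \<in> convex hull X" "0 \<le> s" "s \<le> 1" by blast
    then show ?L by (intro exI[of _ "1 - s"] conjI exI[of _ s] exI[of _ b]) auto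
  next
    assume ?L
    then obtain u v b where "0 \<le> u" "0 \<le> v" "u + v = 1" "b \<in> convex hull X" "y = u *\<^sub>R 0 + v *\<^sub>R b"
      by blast
    then show ?R by (intro exI[of _ v] exI[of _ b]) auto
  qed
  then show ?thesis
    unfolding convex_hull_insert[OF assms] cone_over_def by blast
qed

text \<open>
  One linear map takes the unit cube to the parallelepiped and the standard simplex, of volume
  \<open>1 / d!\<close>, to the cone.
\<close>

lemma measure_parallelepiped:
  fixes A :: "real^'n^'d"
  assumes B: "labeled_basis A B"
  shows "measure lebesgue (parallelepiped A B) =
    fact CARD('d) * measure lebesgue (cone_over (convex hull ((\<lambda>i. column i A) ` B)))"
proof -
  let ?a = "\<lambda>i. column i A" and ?simplex = "convex hull (insert 0 Basis) :: (real^'d) set"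
  have "card (UNIV :: 'd set) = card B" using B by (simp add: labeled_basis_def)
  then obtain g :: "'d \<Rightarrow> 'n" where g: "bij_betw g UNIV B"
    using finite_same_card_bij[of "UNIV :: 'd set" B] by auto
  define f where "f = (\<lambda>y::real^'d. \<Sum>i\<in>UNIV. y $ i *\<^sub>R ?a (g i))"
  have f: "linear f"
    by (rule linearI) (simp_all add: f_def scaleR_left_distrib sum.distrib scaleR_sum_right)
  obtain c where c: "\<And>S. compact S \<Longrightarrow> measure lebesgue (f ` S) = c * measure lebesgue S"
    using linear_image_scales_measure[OF f] by blast
  have unit: "y \<in> cbox 0 One \<longleftrightarrow> (\<forall>i. 0 \<le> y $ i \<and> y $ i \<le> 1)" for y :: "real^'d"
  proof -
    have "y \<in> cbox 0 One \<longleftrightarrow> (\<forall>b\<in>Basis. 0 \<le> y \<bullet> b \<and> y \<bullet> b \<le> 1)" by (simp add: mem_box)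
    then show ?thesis by (simp add: Basis_vec_def inner_axis)
  qed
  have "parallelepiped A B = f ` cbox 0 One"
  proof (intro equalityI subsetI)
    fix v assume "v \<in> parallelepiped A B"
    then obtain l where l: "v = (\<Sum>b\<in>B. l b *\<^sub>R ?a b)" "\<forall>b\<in>B. 0 \<le> l b \<and> l b \<le> 1"
      by (auto simp: parallelepiped_def)
    have "v = f (\<chi> i. l (g i))"
      unfolding l(1) f_def by (simp add: sum.reindex_bij_betw[OF g, symmetric])
    moreover have "(\<chi> i. l (g i)) \<in> cbox 0 One"
      using l(2) bij_betwE[OF g] by (simp add: unit)
    ultimately show "v \<in> f ` cbox 0 One" by blast
  next
    fix v assume "v \<in> f ` cbox 0 One"
    then obtain y where y: "y \<in> cbox 0 One" "v = f y" by blast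
    let ?l = "\<lambda>b. y $ inv_into UNIV g b"
    have "inv_into UNIV g (g i) = i" for i
      using g by (simp add: bij_betw_def)
    then have "v = (\<Sum>b\<in>B. ?l b *\<^sub>R ?a b)"
      unfolding y(2) f_def by (simp add: sum.reindex_bij_betw[OF g, symmetric])
    then show "v \<in> parallelepiped A B"
      using y(1) by (auto simp: parallelepiped_def unit)
  qed
  then have "measure lebesgue (parallelepiped A B) = c"
    using c[of "cbox 0 One"] by (simp add: measure_completion)
  moreover have "cone_over (convex hull (?a ` B)) = f ` ?simplex"
  proof -
    have "f (axis i 1) = ?a (g i)" for i
    proof -
      have "f (axis i 1) = (\<Sum>j\<in>UNIV. if j = i then ?a (g j) else 0)"
        unfolding f_def by (intro sum.cong) (auto simp: axis_def)
      then show ?thesis by simp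
    qed
    then have "f ` Basis = ?a ` g ` UNIV"
      by (auto simp: Basis_vec_def image_iff)
    also have "g ` UNIV = B" using g by (simp add: bij_betw_def)
    finally have "f ` insert 0 Basis = insert 0 (?a ` B)"
      using linear_0[OF f] by simp
    moreover have "?a ` B \<noteq> {}" using bij_betwE[OF g] by auto
    ultimately show ?thesis
      using convex_hull_linear_image[OF f, of "insert 0 Basis"] by (simp add: cone_over_convex_hull)
  qed
  moreover have "compact ?simplex" by (intro finite_imp_compact_convex_hull) simp
  moreover from this have "measure lebesgue ?simplex = 1 / fact CARD('d)"
    using content_std_simplex[where 'a = "real^'d"]
    by (simp add: measure_completion compact_imp_closed)
  ultimately show ?thesis using c[of ?simplex] by simp
qed

section \<open>Generic points\<close>

lemma mem_convex_hull_columns_iff: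
  fixes A :: "real^'n^'d"
  assumes \<phi>: "linear \<phi>" "\<forall>i. \<phi> (column i A) = (1::real)" and x: "\<phi> x = 1"
  shows "x \<in> convex hull ((\<lambda>i. column i A) ` S) \<longleftrightarrow>
    (\<exists>l\<in>barycentric_fiber A x. support_of l \<subseteq> S)"
proof
  let ?a = "\<lambda>i. column i A"
  let ?T = "{l::real^'n. (\<forall>i. 0 \<le> l $ i) \<and> (\<forall>i. i \<notin> S \<longrightarrow> l $ i = 0)}"
  assume "x \<in> convex hull (?a ` S)"
  moreover have "convex hull (?a ` S) \<subseteq> (*v) A ` ?T"
  proof (rule hull_minimal)
    show "?a ` S \<subseteq> (*v) A ` ?T"
    proof clarify
      fix i assume "i \<in> S"
      then have "axis i 1 \<in> ?T" by (auto simp: axis_def)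
      then show "column i A \<in> (*v) A ` ?T"
        using matrix_vector_mult_basis[of A i] by (metis (no_types, lifting) image_eqI)
    qed
    have "convex ?T" by (auto simp: convex_def)
    then show "convex ((*v) A ` ?T)"
      by (rule convex_linear_image[OF matrix_vector_mul_linear])
  qed
  ultimately obtain l where "l \<in> ?T" "x = A *v l" by blast
  then show "\<exists>l\<in>barycentric_fiber A x. support_of l \<subseteq> S"
    by (intro bexI[of _ l]) (auto simp: mem_barycentric_fiber support_of_def)
next
  assume "\<exists>l\<in>barycentric_fiber A x. support_of l \<subseteq> S"
  then obtain l where lQ: "l \<in> barycentric_fiber A x" and lS: "support_of l \<subseteq> S" by blast
  then have l: "\<And>i. 0 \<le> l $ i" "A *v l = x" "support_of l \<subseteq> S"
    by (simp_all add: mem_barycentric_fiber)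
  have "(\<Sum>i\<in>S. l $ i) = (\<Sum>i\<in>UNIV. l $ i)"
    using l(3) by (intro sum.mono_neutral_left) (auto simp: support_of_def)
  also have "\<dots> = 1" using flat_sum_coordinates[OF \<phi>, of l] l(2) x by simp
  finally have "(\<Sum>i\<in>S. l $ i *\<^sub>R column i A) \<in> convex hull ((\<lambda>i. column i A) ` S)"
    using l(1) by (intro convex_sum) (auto intro: hull_inc)
  then show "x \<in> convex hull ((\<lambda>i. column i A) ` S)"
    using matrix_vector_mult_eq_sum_columns[OF l(3), of A] l(2) by simp
qed

lemma flat_convex_hull_columns:
  fixes A :: "real^'n^'d"
  assumes \<phi>: "linear \<phi>" "\<forall>i. \<phi> (column i A) = (1::real)"
    and "x \<in> convex hull ((\<lambda>i. column i A) ` S)"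
  shows "\<phi> x = 1"
proof -
  have "convex hull ((\<lambda>i. column i A) ` S) \<subseteq> {x. \<phi> x = 1}"
  proof (rule hull_minimal)
    show "convex {x. \<phi> x = 1}"
      using \<phi>(1) by (auto simp: convex_def linear_add linear_scale)
  qed (use \<phi> in auto)
  then show ?thesis using assms(3) by blast
qed

lemma convex_hull_basis_iff_feasible:
  fixes A :: "real^'n^'d"
  assumes \<phi>: "linear \<phi>" "\<forall>i. \<phi> (column i A) = (1::real)" and B: "labeled_basis A B" and x: "\<phi> x = 1"
  shows "x \<in> convex hull ((\<lambda>i. column i A) ` B) \<longleftrightarrow> B \<in> feasible_bases A x"
proof -
  have "basis_inverse A B x = l" if "l \<in> barycentric_fiber A x" "support_of l \<subseteq> B" for l
    using that by (intro basis_inverse_eqI[OF B]) (auto simp: mem_barycentric_fiber)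
  then show ?thesis
    using support_basis_inverse[OF B, of x] B
    unfolding mem_convex_hull_columns_iff[OF \<phi> x] feasible_bases_def by auto
qed

text \<open>
  The part removed from the interior of \<open>C\<close> in the definition of the generic points.
\<close>

definition low_hulls :: "real^'n^'d \<Rightarrow> (real^'d) set" where
  "low_hulls A = \<Union> {convex hull ((\<lambda>i. column i A) ` S) | S. S \<noteq> {} \<and> card S < CARD('d)}"

lemma nondegenerate_off_low_hulls:
  fixes A :: "real^'n^'d"
  assumes \<phi>: "linear \<phi>" "\<forall>i. \<phi> (column i A) = (1::real)" and x: "\<phi> x = 1" "x \<notin> low_hulls A"
  shows "nondegenerate A x"
  unfolding nondegenerate_def
proof (rule ballI, rule ccontr)
  fix l assume l: "l \<in> barycentric_fiber A x" "\<not> CARD('d) \<le> card (support_of l)"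
  have "l \<noteq> 0"
    using l x(1) linear_0[OF \<phi>(1)] by (auto simp: mem_barycentric_fiber)
  then have "support_of l \<noteq> {}" by simp
  moreover have "x \<in> convex hull ((\<lambda>i. column i A) ` support_of l)"
    using l mem_convex_hull_columns_iff[OF \<phi> x(1)] by blast
  ultimately have "x \<in> low_hulls A"
    using l(2) unfolding low_hulls_def not_le by blast
  then show False using x(2) by contradiction
qed

text \<open>
  A point of the simplex outside the low hulls has only positive coordinates in the basis \<open>B\<close>,
  which is an open condition in \<open>H\<close>. Hence such a point is interior to \<open>C\<close>.
\<close>

lemma convex_hull_basis_Int_generic_points:
  fixes A :: "real^'n^'d"
  assumes \<phi>: "linear \<phi>" "\<forall>i. \<phi> (column i A) = (1::real)" and H: "H = \<phi> -` {1}"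
    and B: "labeled_basis A B"
  shows "convex hull ((\<lambda>i. column i A) ` B) \<inter> generic_points A H =
    convex hull ((\<lambda>i. column i A) ` B) - low_hulls A"
proof -
  let ?C = "convex hull ((\<lambda>i. column i A) ` B)"
  have "x \<in> generic_points A H" if x: "x \<in> ?C" "x \<notin> low_hulls A" for x
  proof -
    let ?V = "{y. \<forall>b\<in>B. 0 < basis_inverse A B y $ b}"
    have x1: "\<phi> x = 1" using flat_convex_hull_columns[OF \<phi> x(1)] .
    have feas: "B \<in> feasible_bases A x"
      using x convex_hull_basis_iff_feasible[OF \<phi> B x1] by blast
    then have "support_of (basis_inverse A B x) = B"
      using support_feasible_basis[OF nondegenerate_off_low_hulls[OF \<phi> x1 x(2)]] by blast
    then have "x \<in> H \<inter> ?V"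
      using feas x1 H by (auto simp: feasible_bases_def mem_barycentric_fiber support_of_def less_le)
    moreover have "openin (top_of_set H) (H \<inter> ?V)"
    proof -
      have "continuous_on UNIV (basis_inverse A B)"
        using linear_basis_inverse[OF B] by (simp add: linear_continuous_on linear_conv_bounded_linear)
      then have "open {y. 0 < basis_inverse A B y $ b}" for b
        by (intro open_Collect_less continuous_intros)
      then have "open (\<Inter>b\<in>B. {y. 0 < basis_inverse A B y $ b})"
        by (intro open_INT) auto
      also have "(\<Inter>b\<in>B. {y. 0 < basis_inverse A B y $ b}) = ?V" by blast
      finally show ?thesis by (rule openin_open_Int)
    qed
    moreover have "H \<inter> ?V \<subseteq> convex hull (columns A)"
    proof
      fix y assume y: "y \<in> H \<inter> ?V"
      have "0 \<le> basis_inverse A B y $ i" for i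
        using y nth_eq_0_off_support[OF support_basis_inverse[OF B], of i y]
        by (cases "i \<in> B") (auto intro: less_imp_le)
      then have "B \<in> feasible_bases A y"
        using B matrix_basis_inverse[OF B] by (simp add: feasible_bases_def mem_barycentric_fiber)
      then have "y \<in> ?C"
        using y H convex_hull_basis_iff_feasible[OF \<phi> B] by auto
      moreover have "?C \<subseteq> convex hull (columns A)"
        by (rule hull_mono) (auto simp: columns_def)
      ultimately show "y \<in> convex hull (columns A)" by blast
    qed
    ultimately have "x \<in> top_of_set H interior_of (convex hull (columns A))"
      using interior_of_maximal by blast
    then show ?thesis using x(2) by (simp add: generic_points_def low_hulls_def)
  qed
  moreover have "generic_points A H \<inter> low_hulls A = {}"
    by (auto simp: generic_points_def low_hulls_def)
  ultimately show ?thesis by blast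
qed

lemma closed_low_hulls:
  fixes A :: "real^'n^'d"
  shows "closed (low_hulls A)"
  unfolding low_hulls_def
  by (rule closed_Union) (auto intro!: compact_imp_closed finite_imp_compact_convex_hull)

text \<open>
  The cone over the convex hull of fewer than \<open>d\<close> columns lies in a proper linear subspace.
\<close>

lemma negligible_cone_over_low_hulls:
  fixes A :: "real^'n^'d"
  shows "negligible (cone_over (low_hulls A))"
proof (rule negligible_subset)
  let ?a = "\<lambda>i. column i A"
  let ?U = "\<Union>S\<in>{S. card S < CARD('d)}. span (?a ` S)"
  show "negligible ?U"
  proof (intro negligible_Union, simp, clarify)
    fix S :: "'n set" assume "card S < CARD('d)"
    moreover have "dim (span (?a ` S)) \<le> card (?a ` S)"
      by (simp add: dim_le_card')
    moreover have "card (?a ` S) \<le> card S" by (simp add: card_image_le)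
    ultimately show "negligible (span (?a ` S))" by (intro negligible_lowdim) simp
  qed
  show "cone_over (low_hulls A) \<subseteq> ?U"
  proof
    fix y assume "y \<in> cone_over (low_hulls A)"
    then obtain s x S where y: "y = s *\<^sub>R x" and x: "x \<in> convex hull (?a ` S)" and S: "card S < CARD('d)"
      unfolding cone_over_def low_hulls_def by blast
    have "y \<in> span (?a ` S)"
      unfolding y using x convex_hull_subset_span[of "?a ` S"] by (intro span_scale) blast
    then show "y \<in> ?U" using S by blast
  qed
qed

text \<open>
  Removing the low hulls from the simplex leaves a Borel set and changes the cone only by a null set.
\<close>

lemma cone_measure_basis_hull:
  fixes A :: "real^'n^'d"
  assumes \<phi>: "linear \<phi>" "\<forall>i. \<phi> (column i A) = (1::real)" and H: "H = \<phi> -` {1}"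
    and B: "labeled_basis A B"
  defines "E \<equiv> convex hull ((\<lambda>i. column i A) ` B) - low_hulls A"
  shows "E \<in> sets (cone_measure H)" "emeasure (cone_measure H) E < \<infinity>"
    "fact CARD('d) * measure (cone_measure H) E = measure lebesgue (parallelepiped A B)"
proof -
  let ?C = "convex hull ((\<lambda>i. column i A) ` B)"
  have "B \<noteq> {}" using B by (auto simp: labeled_basis_def)
  have "compact ?C" by (intro finite_imp_compact_convex_hull) simp
  have "closed H"
    unfolding H using \<phi>(1)
    by (intro closed_vimage) (simp_all add: linear_continuous_on linear_conv_bounded_linear)
  moreover have "E \<subseteq> H" using flat_convex_hull_columns[OF \<phi>] H by (auto simp: E_def)
  moreover have "E \<in> sets borel"
    unfolding E_def using compact_imp_closed[OF \<open>compact ?C\<close>] closed_low_hulls[of A]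
    by (intro sets.Diff borel_closed)
  ultimately have E: "E \<in> sets (restrict_space borel H)"
    by (simp add: sets_restrict_space_iff)
  then show "E \<in> sets (cone_measure H)" by (simp add: sets_cone_measure)
  have em: "emeasure (cone_measure H) E = emeasure lebesgue (cone_over E)"
    by (rule emeasure_cone_measure[OF \<phi>(1) H E])
  have "cone_over ?C = convex hull (insert 0 ((\<lambda>i. column i A) ` B))"
    using \<open>B \<noteq> {}\<close> by (intro cone_over_convex_hull) simp
  then have C: "cone_over ?C \<in> lmeasurable"
    by (auto intro!: lmeasurable_compact finite_imp_compact_convex_hull)
  have "(cone_over ?C - cone_over E) \<union> (cone_over E - cone_over ?C) \<subseteq> cone_over (low_hulls A)"
    by (auto simp: cone_over_def E_def)
  then have null: "negligible ((cone_over ?C - cone_over E) \<union> (cone_over E - cone_over ?C))"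
    by (rule negligible_subset[OF negligible_cone_over_low_hulls])
  show "emeasure (cone_measure H) E < \<infinity>"
    unfolding em using lmeasurable_negligible_symdiff[OF C null]
    by (simp only: infinity_ennreal_def fmeasurableD2 less_top[symmetric] not_False_eq_True)
  show "fact CARD('d) * measure (cone_measure H) E = measure lebesgue (parallelepiped A B)"
    unfolding measure_parallelepiped[OF B] measure_negligible_symdiff[OF C null, symmetric]
    by (simp add: measure_def em)
qed

section \<open>The integral of the \<open>h\<close>-polynomials\<close>

text \<open>
  The integrand is a finite sum of indicators of Borel sets, one for each basis: \<open>B\<close> gives a vertex
  of the fiber over \<open>x\<close> exactly when \<open>x\<close> lies in the simplex spanned by \<open>B\<close>. Both integrability
  and the value of the integral can be read off from this form.
\<close>

lemma coeff_h_poly_on_generic_points: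
  fixes A :: "real^'n^'d"
  assumes \<phi>: "linear \<phi>" "\<forall>i. \<phi> (column i A) = (1::real)" and H: "H = \<phi> -` {1}"
    and gen: "circuit_generic A \<rho>"
  shows "indicator (generic_points A H) x *\<^sub>R coeff (h_poly (barycentric_fiber A x)) k =
    (\<Sum>B | labeled_basis A B \<and> ext_semi A \<rho> B = k.
      indicator (convex hull ((\<lambda>i. column i A) ` B) - low_hulls A) x :: real)"
    (is "_ = (\<Sum>B\<in>?I. indicator (?E B) x)")
proof (cases "x \<in> generic_points A H")
  case True
  then have "x \<in> H"
    using interior_of_subset_topspace[of "top_of_set H"] by (auto simp: generic_points_def)
  then have x1: "\<phi> x = 1" using H by simp
  have x: "x \<notin> low_hulls A" using True by (simp add: generic_points_def low_hulls_def)
  have "coeff (h_poly (barycentric_fiber A x)) k =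
      (\<Sum>B\<in>feasible_bases A x. if ext_semi A \<rho> B = k then 1 else 0)"
    using h_poly_barycentric_fiber[OF \<phi> gen nondegenerate_off_low_hulls[OF \<phi> x1 x]]
    by (simp add: coeff_sum)
  also have "\<dots> = (\<Sum>B\<in>?I. if B \<in> feasible_bases A x then 1 else 0)"
    unfolding sum.inter_filter[OF finite, symmetric]
    by (intro sum.cong) (auto simp: feasible_bases_def)
  also have "\<dots> = (\<Sum>B\<in>?I. indicator (?E B) x)"
    using x convex_hull_basis_iff_feasible[OF \<phi> _ x1]
    by (intro sum.cong) (auto simp: indicator_def)
  finally show ?thesis using True by simp
next
  case False
  then have "x \<notin> ?E B" if "B \<in> ?I" for B
    using convex_hull_basis_Int_generic_points[OF \<phi> H, of B] that by blast
  then show ?thesis using False by simp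
qed

theorem proposition5p2:
  fixes A :: "real^'n^'d" and \<phi> :: "real^'d \<Rightarrow> real" and H :: "(real^'d) set"
  assumes "full_dimensional A"
    and "linear \<phi>" and "\<forall>i. \<phi> (column i A) = 1"
    and "H = \<phi> -` {1}"
  shows "\<forall>\<rho>. circuit_generic A \<rho> \<longrightarrow>
      (\<forall>k. set_integrable (cone_measure H) (generic_points A H)
             (\<lambda>x. coeff (h_poly (barycentric_fiber A x)) k) \<and>
           coeff (f_poly A \<rho>) k =
             fact CARD('d) *
             (LINT x:generic_points A H|cone_measure H. coeff (h_poly (barycentric_fiber A x)) k)) \<and>
      (\<forall>\<rho>'. circuit_generic A \<rho>' \<longrightarrow> f_poly A \<rho>' = f_poly A \<rho>) \<and>
      f_poly A \<rho> = common_f_poly A"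
proof (intro allI impI)
  note \<phi> = assms(2,3) and H = assms(4)
  let ?int = "\<lambda>k. LINT x:generic_points A H|cone_measure H. coeff (h_poly (barycentric_fiber A x)) k"
  have main: "set_integrable (cone_measure H) (generic_points A H)
        (\<lambda>x. coeff (h_poly (barycentric_fiber A x)) k)"
      "coeff (f_poly A \<rho>) k = fact CARD('d) * ?int k"
    if gen: "circuit_generic A \<rho>" for \<rho> k
  proof -
    let ?I = "{B. labeled_basis A B \<and> ext_semi A \<rho> B = k}"
    let ?E = "\<lambda>B. convex hull ((\<lambda>i. column i A) ` B) - low_hulls A"
    have E: "has_bochner_integral (cone_measure H) (\<lambda>x. \<Sum>B\<in>?I. indicator (?E B) x :: real)
        (\<Sum>B\<in>?I. measure (cone_measure H) (?E B))"
      using cone_measure_basis_hull[OF \<phi> H]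
      by (intro has_bochner_integral_sum has_bochner_integral_real_indicator) auto
    then show "set_integrable (cone_measure H) (generic_points A H)
        (\<lambda>x. coeff (h_poly (barycentric_fiber A x)) k)"
      unfolding set_integrable_def coeff_h_poly_on_generic_points[OF \<phi> H gen]
      by (rule integrable.intros)
    have "?int k = (\<Sum>B\<in>?I. measure (cone_measure H) (?E B))"
      using E unfolding set_lebesgue_integral_def coeff_h_poly_on_generic_points[OF \<phi> H gen]
      by (rule has_bochner_integral_integral_eq)
    then have "fact CARD('d) * ?int k = (\<Sum>B\<in>?I. measure lebesgue (parallelepiped A B))"
      using cone_measure_basis_hull(3)[OF \<phi> H] by (simp add: sum_distrib_left)
    also have "\<dots> = coeff (f_poly A \<rho>) k"
      unfolding f_poly_def coeff_sum coeff_monom by (simp flip: sum.inter_filter)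
    finally show "coeff (f_poly A \<rho>) k = fact CARD('d) * ?int k" by simp
  qed
  fix \<rho> assume gen: "circuit_generic A \<rho>"
  have same: "f_poly A \<rho>' = f_poly A \<rho>" if "circuit_generic A \<rho>'" for \<rho>'
    by (rule poly_eqI) (simp only: main(2)[OF gen] main(2)[OF that])
  have "common_f_poly A = f_poly A \<rho>"
    unfolding common_f_poly_def by (rule the_equality) (use gen same in blast)+
  then show "(\<forall>k. set_integrable (cone_measure H) (generic_points A H)
             (\<lambda>x. coeff (h_poly (barycentric_fiber A x)) k) \<and>
           coeff (f_poly A \<rho>) k = fact CARD('d) * ?int k) \<and>
      (\<forall>\<rho>'. circuit_generic A \<rho>' \<longrightarrow> f_poly A \<rho>' = f_poly A \<rho>) \<and>
      f_poly A \<rho> = common_f_poly A"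
    using main(1)[OF gen] main(2)[OF gen] same by (intro conjI allI impI) (assumption | simp only:)+
qed

end
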